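(* Let $\mu,\lambda$ be infinite cardinals and let $\langle\chi_i:i<\mathrm{cf}(\lambda)\rangle$ be an increasing sequence of regular cardinals such that \[\mathrm{cf}(\lambda)<\mu=\left(2^{\mathrm{cf}(\lambda)}\right)^+<\lambda=\sup_{i<\mathrm{cf}(\lambda)}\chi_i\quad\text{and}\quad \mu<\chi_0 .\] If $\mathbb{B}$ is a Boolean algebra satisfying $\mathrm{hL}(\mathbb{B})=\lambda$, then \[\mathrm{hL}_{(0)}^+(\mathbb{B})=\mathrm{hL}_{(1)}^+(\mathbb{B})=\mathrm{hL}_{(7)}^+(\mathbb{B})=\lambda^+.\]
   Context: $\mathrm{Ult}(\mathbb{B})$ is the Stone space (space of ultrafilters) of $\mathbb{B}$. For a topological space $X$, $\mathrm{L}(X)$ is the least (infinite) cardinal $\kappa$ such that every open cover of $X$ has a subcover of size $\leq\kappa$. For an ideal $I$ of $\mathbb{B}$, $\mathrm{cof}(I)=\min\{|A|:A\subseteq I\text{ and }(\forall b\in I)(\exists a\in A)(b\leq a)\}$. A sequence $\langle a_\xi:\xi<\kappa\rangle$ of elements of $\mathbb{B}$ is right-separated if $a_\xi\nleq\bigvee_{\zeta\in w}a_\zeta$ for each $\xi<\kappa$ and each finite $w\subseteq\xi$. For an infinite Boolean algebra $\mathbb{B}$: - $\mathrm{hL}(\mathbb{B})=\sup\{\kappa:\text{there is a right-separated sequence of length }\kappa\text{ in }\mathbb{B}\}$ (the hereditary Lindelöf degree; $\kappa$ ranges over cardinals); - $\mathrm{hL}_{(0)}^{+}(\mathbb{B})=\sup\{\mathrm{L}(X)^{+}:X\text{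 is a subspace of }\mathrm{Ult}(\mathbb{B})\}$; - $\mathrm{hL}_{(1)}^{+}(\mathbb{B})=\sup\{\mathrm{cof}(I)^{+}:I\text{ is an ideal of }\mathbb{B}\}$; - $\mathrm{hL}_{(7)}^{+}(\mathbb{B})=\sup\{\kappa^{+}:\text{there is a right-separated sequence }\langle a_\xi:\xi<\kappa\rangle\text{ in }\mathbb{B}\}$. Here $\kappa^+$ denotes the cardinal successor of $\kappa$. *)

theory Defs
  imports "HOL-Analysis.Abstract_Topology"
begin

unbundle cardinal_syntax

text \<open>
  Cardinals are well-orders \<open>r\<close> with \<open>Card_order r\<close>, compared across types by
  \<open>=o\<close>, \<open>\<le>o\<close>, \<open><o\<close>; the ordinals below such a cardinal are the elements of
  \<open>Field r\<close>, in the order \<open>r\<close>.  The successor cardinal is \<open>cardSuc\<close>.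

  Since a cardinal lives on some type, so do minima and suprema of sets of cardinals.  No
  generality is lost: a set of cardinals on \<open>'k\<close> is bounded by the cardinality of \<open>'k\<close>,
  hence its supremum is again represented on \<open>'k\<close>.  Both operations
  determine their value only up to \<open>=o\<close>.
\<close>

definition card_Min :: "'k rel set \<Rightarrow> 'k rel" where
  "card_Min R = (SOME r. r \<in> R \<and> (\<forall>s\<in>R. r \<le>o s))"

definition card_Sup :: "'k rel set \<Rightarrow> 'k rel" where
  "card_Sup R = card_Min {s. Card_order s \<and> (\<forall>r\<in>R. r \<le>o s)}"

lemma card_Min:
  assumes "R \<noteq> {}" and "\<And>r. r \<in> R \<Longrightarrow> Card_order r"
  shows "card_Min R \<in> R" and "\<And>s. s \<in> R \<Longrightarrow> card_Min R \<le>o s"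
proof -
  have "\<exists>r. r \<in> R \<and> (\<forall>s\<in>R. r \<le>o s)"
    using exists_minim_Card_order[of R] assms by blast
  then have "card_Min R \<in> R \<and> (\<forall>s\<in>R. card_Min R \<le>o s)"
    unfolding card_Min_def by (rule someI_ex)
  then show "card_Min R \<in> R" and "\<And>s. s \<in> R \<Longrightarrow> card_Min R \<le>o s"
    by blast+
qed

lemma card_Sup:
  fixes R :: "'k rel set"
  assumes "\<And>r. r \<in> R \<Longrightarrow> Card_order r"
  shows "Card_order (card_Sup R)"
    and "\<And>r. r \<in> R \<Longrightarrow> r \<le>o card_Sup R"
    and "\<And>s :: 'm rel. Card_order s \<Longrightarrow> (\<And>r. r \<in> R \<Longrightarrow> r \<le>o s) \<Longrightarrow> card_Sup R \<le>o s"
proof -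
  let ?S = "{s :: 'k rel. Card_order s \<and> (\<forall>r\<in>R. r \<le>o s)}"
  have UN: "|UNIV :: 'k set| \<in> ?S"
    using assms card_of_Card_order card_of_mono1[OF subset_UNIV]
      ordIso_ordLeq_trans[OF ordIso_symmetric[OF card_of_Field_ordIso]]
    by blast
  then have ne: "?S \<noteq> {}" by blast
  have m: "card_Sup R \<in> ?S" "\<And>s. s \<in> ?S \<Longrightarrow> card_Sup R \<le>o s"
    unfolding card_Sup_def using card_Min[of ?S, OF ne] by simp_all
  show "Card_order (card_Sup R)" and "\<And>r. r \<in> R \<Longrightarrow> r \<le>o card_Sup R"
    using m(1) by auto
  show "card_Sup R \<le>o s"
    if s: "Card_order s" "\<And>r. r \<in> R \<Longrightarrow> r \<le>o s" for s :: "'m rel"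
  proof (rule ccontr)
    assume "\<not> card_Sup R \<le>o s"
    then have lt: "s <o card_Sup R"
      using s(1) \<open>Card_order (card_Sup R)\<close> 
      by (meson card_order_on_well_order_on not_ordLeq_iff_ordLess)
    then have "|Field s| \<le>o |Field (card_Sup R)|"
      by (simp add: card_of_mono2 ordLess_imp_ordLeq)
    then obtain f where f: "inj_on f (Field s)" "f ` Field s \<subseteq> Field (card_Sup R)"
      using card_of_ordLeq[of "Field s" "Field (card_Sup R)"] by blast
    let ?t = "|f ` Field s|"
    have "|Field s| =o ?t"
      using f(1) card_of_ordIso[of "Field s"] by (meson bij_betw_imageI)
    then have st: "s =o ?t"
      using ordIso_transitive[OF ordIso_symmetric[OF card_of_Field_ordIso[OF s(1)]]] by blast
    then have "?t \<in> ?S"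
      using s(2) ordLeq_ordIso_trans by (auto simp: card_of_Card_order)
    then have "card_Sup R \<le>o ?t" by (rule m(2))
    then have "card_Sup R \<le>o s" using st by (meson ordIso_symmetric ordLeq_ordIso_trans)
    with lt show False using not_ordLess_ordLeq by blast
  qed
qed

text \<open>
  \<^const>\<open>cofinal\<close> is strict, which makes no difference for infinite cardinals.
\<close>

definition cofinality :: "'k rel \<Rightarrow> 'k rel" where
  "cofinality r = card_Min {|K| | K. K \<subseteq> Field r \<and> cofinal K r}"


text \<open>
  A Boolean algebra is a type of class \<^class>\<open>boolean_algebra\<close>; its cardinal invariants
  take the type as argument.
\<close>

definition ba_ideal :: "'b::boolean_algebra set \<Rightarrow> bool" where
  "ba_ideal I \<longleftrightarrow> bot \<in> I \<and> (\<forall>a\<in>I. \<forall>b. b \<le> a \<longrightarrow> b \<in> I) \<and> (\<forall>a\<in>I. \<forall>b\<in>I. sup a b \<in> I)"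

definition ba_proper_filter :: "'b::boolean_algebra set \<Rightarrow> bool" where
  "ba_proper_filter F \<longleftrightarrow>
     top \<in> F \<and> bot \<notin> F \<and> (\<forall>a\<in>F. \<forall>b. a \<le> b \<longrightarrow> b \<in> F) \<and> (\<forall>a\<in>F. \<forall>b\<in>F. inf a b \<in> F)"

definition ba_ultrafilter :: "'b::boolean_algebra set \<Rightarrow> bool" where
  "ba_ultrafilter U \<longleftrightarrow>
     ba_proper_filter U \<and> (\<forall>F. ba_proper_filter F \<longrightarrow> U \<subseteq> F \<longrightarrow> F = U)"

definition Ult :: "'b::boolean_algebra itself \<Rightarrow> 'b set topology" where
  "Ult B = topology_generated_by {{U. ba_ultrafilter U \<and> b \<in> U} | b. True}"

lemma topspace_Ult: "topspace (Ult B) = {U. ba_ultrafilter U}"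
  unfolding Ult_def topology_generated_by_topspace
  by (auto simp: ba_ultrafilter_def ba_proper_filter_def)

text \<open>
  \<open>L(X)\<close> is at most the maximum of \<open>\<aleph>\<^sub>0\<close> and the number of points of \<open>X\<close>, hence is
  represented on the type \<open>'p + nat\<close>.
\<close>

definition Lindelof_degree :: "'p topology \<Rightarrow> ('p + nat) rel" where
  "Lindelof_degree X = card_Min {\<kappa>. Cinfinite \<kappa> \<and>
     (\<forall>\<U>. (\<forall>U\<in>\<U>. openin X U) \<and> topspace X \<subseteq> \<Union>\<U> \<longrightarrow>
        (\<exists>\<V>\<subseteq>\<U>. topspace X \<subseteq> \<Union>\<V> \<and> |\<V>| \<le>o \<kappa>))}"

lemma Lindelof_degree_exists:
  fixes X :: "'p topology"
  shows "\<exists>\<kappa> :: ('p + nat) rel. Cinfinite \<kappa> \<and>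
     (\<forall>\<U>. (\<forall>U\<in>\<U>. openin X U) \<and> topspace X \<subseteq> \<Union>\<U> \<longrightarrow>
        (\<exists>\<V>\<subseteq>\<U>. topspace X \<subseteq> \<Union>\<V> \<and> |\<V>| \<le>o \<kappa>))"
proof (rule exI[of _ "|UNIV :: ('p + nat) set|"], intro conjI allI impI)
  show "cinfinite |UNIV :: ('p + nat) set|"
    by (simp add: cinfinite_def Field_card_of)
  show "Card_order |UNIV :: ('p + nat) set|"
    by (rule card_of_Card_order)
  fix \<U> assume "(\<forall>U\<in>\<U>. openin X U) \<and> topspace X \<subseteq> \<Union>\<U>"
  then have "\<forall>x\<in>topspace X. \<exists>U\<in>\<U>. x \<in> U" by blast
  then obtain f where f: "\<forall>x\<in>topspace X. f x \<in> \<U> \<and> x \<in> f x" by metis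
  have "|topspace X| \<le>o |UNIV :: ('p + nat) set|"
    by (rule card_of_ordLeqI[of Inl]) (auto simp: inj_on_def)
  then have "|f ` topspace X| \<le>o |UNIV :: ('p + nat) set|"
    by (rule ordLeq_transitive[OF card_of_image])
  then show "\<exists>\<V>\<subseteq>\<U>. topspace X \<subseteq> \<Union>\<V> \<and> |\<V>| \<le>o |UNIV :: ('p + nat) set|"
    using f by (intro exI[of _ "f ` topspace X"]) auto
qed

definition ideal_cof :: "'b::boolean_algebra set \<Rightarrow> 'b rel" where
  "ideal_cof I = card_Min {|A| | A. A \<subseteq> I \<and> (\<forall>b\<in>I. \<exists>a\<in>A. b \<le> a)}"

text \<open>
  Inserting \<^const>\<open>bot\<close> makes the finite join equal to \<^const>\<open>bot\<close> for \<open>w = {}\<close>.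
\<close>

definition right_separated :: "'k rel \<Rightarrow> ('k \<Rightarrow> 'b::boolean_algebra) \<Rightarrow> bool" where
  "right_separated \<kappa> a \<longleftrightarrow>
     (\<forall>\<xi>\<in>Field \<kappa>. \<forall>w. finite w \<and> w \<subseteq> underS \<kappa> \<xi> \<longrightarrow>
        \<not> a \<xi> \<le> Sup_fin (insert bot (a ` w)))"

text \<open>
  Right-separated sequences are injective, so it is enough to consider lengths that are
  cardinals on the type of the algebra itself.
\<close>

lemma right_separated_length:
  fixes a :: "'k \<Rightarrow> 'b::boolean_algebra"
  assumes "Card_order \<kappa>" "right_separated \<kappa> a"
  shows "\<kappa> \<le>o |UNIV :: 'b set|"
proof -
  have less: "a \<xi> \<noteq> a \<zeta>" if "\<xi> \<in> Field \<kappa>" "\<zeta> \<in> underS \<kappa> \<xi>" for \<xi> \<zeta>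
    using assms(2) that unfolding right_separated_def
    by (auto dest!: bspec[OF _ that(1)] spec[of _ "{\<zeta>}"])
  have tot: "total_on (Field \<kappa>) \<kappa>"
    using assms(1) unfolding card_order_on_def well_order_on_def linear_order_on_def by blast
  have "inj_on a (Field \<kappa>)"
  proof (rule inj_onI, rule ccontr)
    fix x y assume xy: "x \<in> Field \<kappa>" "y \<in> Field \<kappa>" "a x = a y" "x \<noteq> y"
    then have "x \<in> underS \<kappa> y \<or> y \<in> underS \<kappa> x"
      using tot unfolding total_on_def underS_def by blast
    then show False using less xy by metis
  qed
  then have "|Field \<kappa>| \<le>o |UNIV :: 'b set|"
    by (rule card_of_ordLeqI) auto
  then show ?thesis
    using card_of_Field_ordIso[OF assms(1)] ordIso_ordLeq_trans ordIso_symmetric by blast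
qed

definition hL :: "'b::boolean_algebra itself \<Rightarrow> 'b rel" where
  "hL B = card_Sup {\<kappa>. Card_order \<kappa> \<and> (\<exists>a :: 'b \<Rightarrow> 'b. right_separated \<kappa> a)}"

definition hL0_plus :: "'b::boolean_algebra itself \<Rightarrow> ('b set + nat) set rel" where
  "hL0_plus B = card_Sup {cardSuc (Lindelof_degree (subtopology (Ult B) X)) | X.
     X \<subseteq> topspace (Ult B)}"

definition hL1_plus :: "'b::boolean_algebra itself \<Rightarrow> 'b set rel" where
  "hL1_plus B = card_Sup {cardSuc (ideal_cof I) | I :: 'b set. ba_ideal I}"

definition hL7_plus :: "'b::boolean_algebra itself \<Rightarrow> 'b set rel" where
  "hL7_plus B = card_Sup {cardSuc \<kappa> | \<kappa>.
     Card_order \<kappa> \<and> (\<exists>a :: 'b \<Rightarrow> 'b. right_separated \<kappa> a)}"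

end

theory Submission
  imports Defs
begin

text \<open>
  Write \<open>\<theta>\<close> for the cofinality of \<open>\<lambda> = lam\<close>.  All three invariants are governed by ideals.  From an
  ideal of infinite cofinality \<open>\<kappa>\<close> one picks greedily a right-separated sequence of length \<open>\<kappa>\<close>
  (\<open>right_separated_of_ideal\<close>), so no cofinality of an ideal exceeds \<open>hL = \<lambda>\<close>.  An open cover of a subspace
  \<open>X\<close> of the Stone space gives the ideal of those elements whose trace on \<open>X\<close> is finitely covered,
  and a cofinal subset of it gives a subcover, so no Lindelof degree exceeds \<open>\<lambda>\<close> either
  (\<open>Lindelof_subspace_le\<close>).  Conversely, by compactness, the open set of the points that meet an ideal \<open>I\<close>
  has Lindelof degree at least \<open>cof(I)\<close> (\<open>ideal_cof_le_Lindelof\<close>).  Hence all three suprema are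
  \<open>\<lambda>\<^sup>+\<close> as soon as a single ideal has cofinality at least \<open>\<lambda>\<close>
  (\<open>ideal_of_large_cofinality\<close>).

  To find that ideal, take for each \<open>i < \<theta>\<close> a right-separated sequence of length \<open>\<chi>\<^sub>i\<close> and realise it by
  a set \<open>X\<^sub>i\<close> of \<open>\<chi>\<^sub>i\<close> ultrafilters.  Call a subset of \<open>X\<^sub>i\<close> small if it has fewer than \<open>\<chi>\<^sub>i\<close> points and
  large otherwise.  Given large sets \<open>Y\<^sub>i \<subseteq> X\<^sub>i\<close>, let \<open>J(Y)\<close> be the ideal of the elements whose trace on every
  \<open>Y\<^sub>i\<close> is small.  If \<open>J(Y)\<close> covers a large part of \<open>Y\<^sub>i\<close>, then \<open>cof(J(Y)) \<ge> \<chi>\<^sub>i\<close> because \<open>\<chi>\<^sub>i\<close> is regular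
  (\<open>ordLeq_cof_small_ideal\<close>).  Whether one can choose \<open>Y\<close> so that \<open>J(Y)\<close> covers enough is decided by a
  dichotomy for each \<open>i\<close>, on the number of elements that can be told apart by large sets.

  In the first case some large \<open>Y\<^sub>i \<subseteq> X\<^sub>i\<close> admits at most \<open>2\<^sup>\<theta>\<close> elements modulo smallness on \<open>Y\<^sub>i\<close>.
  For \<open>\<theta>\<close> many such \<open>i\<close> together there are still only \<open>(2\<^sup>\<theta>)\<^sup>\<theta> = 2\<^sup>\<theta>\<close> classes modulo \<open>J(Y)\<close>.
  The separating neighbourhoods of two points outside the part covered by \<open>J(Y)\<close> lie in different
  classes, so \<open>J(Y)\<close> misses at most \<open>2\<^sup>\<theta> < \<chi>\<^sub>i\<close> points of \<open>Y\<^sub>i\<close> (\<open>ideal_of_few_classes\<close>).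

  In the second case every large subset of \<open>X\<^sub>i\<close> tells more than \<open>2\<^sup>\<theta>\<close> elements apart.  Two of them must
  agree on any prescribed \<open>\<theta>\<close> points, and their symmetric difference is an element that avoids all
  these points but has a large trace.  A recursion of length \<open>\<theta>\<close> turns this into elements \<open>c\<^sub>i\<close> such that
  the points of \<open>X\<^sub>i\<close> in \<open>c\<^sub>i\<close> and in no other \<open>c\<^sub>j\<close> form a large set \<open>Y\<^sub>i\<close>.  The \<open>Y\<^sub>i\<close> are then relatively
  clopen in their union, and \<open>J(Y)\<close> covers every \<open>Y\<^sub>i\<close> (\<open>ideal_of_many_classes\<close>).

  One of the two cases occurs for cofinally many \<open>\<chi>\<^sub>i\<close>, so one of the two ideals has cofinality at
  least \<open>\<lambda>\<close>.
\<close>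

section \<open>Cardinal arithmetic around the successor of a power of two\<close>

lemma card_not_ordLess:
  assumes "Card_order r" "Card_order s"
  shows "\<not> r <o s \<longleftrightarrow> s \<le>o r"
  using assms by (simp add: not_ordLess_iff_ordLeq card_order_on_well_order_on)

lemma card_of_ordLessI: "Card_order r \<Longrightarrow> \<not> r \<le>o |A| \<Longrightarrow> |A| <o r"
  using card_not_ordLess[OF card_of_Card_order] by fast

lemma ordLess_subset: "A \<subseteq> A' \<Longrightarrow> |A'| <o r \<Longrightarrow> |A| <o r"
  using card_of_mono1 ordLeq_ordLess_trans by blast

lemma finite_ordLess_Cinfinite: "finite A \<Longrightarrow> Cinfinite r \<Longrightarrow> |A| <o r"
  by (intro Cfinite_ordLess_Cinfinite)
    (simp_all add: cfinite_def Field_card_of card_of_card_order_on)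

lemma empty_ordLess: "Cinfinite r \<Longrightarrow> |{}| <o r"
  by (simp add: finite_ordLess_Cinfinite)

lemma finite_subsets_bound:
  assumes "|A| \<le>o r" "Cinfinite r"
  shows "|{F. finite F \<and> F \<subseteq> A}| \<le>o r"
proof -
  define P where "P n = {F. finite F \<and> F \<subseteq> A \<and> card F = n}" for n
  have "|P n| \<le>o r" for n
  proof (induction n)
    case 0
    have "P 0 \<subseteq> {{}}" by (auto simp: P_def)
    then have "|P 0| \<le>o |{{} :: 'a set}|" by (rule card_of_mono1)
    also have "|{{} :: 'a set}| \<le>o r"
      using assms(2) by (intro Card_order_singl_ordLeq) (auto simp: cinfinite_def)
    finally show ?case .
  next
    case (Suc n)
    have "P (Suc n) \<subseteq> (\<Union>a\<in>A. insert a ` P n)"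
    proof
      fix F assume F: "F \<in> P (Suc n)"
      then have "F \<noteq> {}" by (auto simp: P_def)
      then obtain a where "a \<in> F" by blast
      with F have "F = insert a (F - {a})" "F - {a} \<in> P n" "a \<in> A"
        by (auto simp: P_def)
      then show "F \<in> (\<Union>a\<in>A. insert a ` P n)" by blast
    qed
    then have "|P (Suc n)| \<le>o |\<Union>a\<in>A. insert a ` P n|" by (rule card_of_mono1)
    also have "|\<Union>a\<in>A. insert a ` P n| \<le>o r"
      using assms Suc by (intro UNION_Cinfinite_bound ballI) (auto intro: ordLeq_transitive[OF card_of_image])
    finally show ?case .
  qed
  moreover have "|UNIV :: nat set| \<le>o r"
    using assms(2) by (metis card_of_nat natLeq_ordLeq_cinfinite ordIso_ordLeq_trans)
  ultimately have "|\<Union>n. P n| \<le>o r"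
    using assms(2) by (intro UNION_Cinfinite_bound) auto
  moreover have "{F. finite F \<and> F \<subseteq> A} = (\<Union>n. P n)" by (auto simp: P_def)
  ultimately show ?thesis by simp
qed

context
  fixes \<theta> :: "'i rel"
  assumes \<theta>: "Cinfinite \<theta>"
begin

abbreviation (input) two_pow :: "('i \<Rightarrow> bool) rel" where
  "two_pow \<equiv> ctwo ^c \<theta>"

abbreviation (input) two_pow_suc :: "('i \<Rightarrow> bool) set rel" where
  "two_pow_suc \<equiv> cardSuc two_pow"

lemma Cinfinite_two_pow: "Cinfinite two_pow"
  using \<theta> by (intro Cinfinite_cexp) (auto intro: ordLeq_refl Card_order_ctwo)

lemma Cinfinite_two_pow_suc: "Cinfinite two_pow_suc"
  by (rule Cinfinite_cardSuc[OF Cinfinite_two_pow])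

lemma ordLeq_two_pow: "\<theta> \<le>o two_pow"
  using \<theta> by (meson ordLess_ctwo_cexp ordLess_imp_ordLeq)

lemma two_pow_ordLess_suc: "two_pow <o two_pow_suc"
  using Cinfinite_two_pow cardSuc_greater by blast

lemma ordLeq_two_pow_suc: "\<theta> \<le>o two_pow_suc"
  using ordLeq_two_pow two_pow_ordLess_suc ordLeq_transitive ordLess_imp_ordLeq by blast

lemma card_of_Func_two_pow:
  assumes "|C| \<le>o two_pow"
  shows "|Func (Field \<theta>) C| \<le>o two_pow"
proof -
  have "|Func (Field \<theta>) C| = |C| ^c \<theta>" by (simp add: cexp_def Field_card_of)
  also have "|C| ^c \<theta> \<le>o two_pow ^c \<theta>" using assms \<theta> by (intro cexp_mono1) auto
  also have "two_pow ^c \<theta> =o two_pow"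
    using \<theta> by (intro cexp_cprod_ordLeq Card_order_ctwo Cinfinite_Cnotzero ordLeq_refl) auto
  finally show ?thesis .
qed

text \<open>
  Hausdorff's formula: \<open>\<theta>\<close> is below the cofinality of \<open>\<kappa> = (2\<^sup>\<theta>)\<^sup>+\<close>, so every function from
  \<open>\<theta>\<close> to \<open>\<kappa>\<close> is bounded, and below each bound there are at most \<open>(2\<^sup>\<theta>)\<^sup>\<theta> = 2\<^sup>\<theta>\<close> of them.
\<close>

lemma card_of_Func_two_pow_suc: "|Func (Field \<theta>) (Field two_pow_suc)| \<le>o two_pow_suc"
proof -
  let ?k = two_pow_suc
  have k: "Card_order ?k" "\<not> finite (Field ?k)"
    using Cinfinite_two_pow_suc by (auto simp: cinfinite_def)
  then have wo: "wo_rel ?k" by (simp add: wo_rel_def card_order_on_well_order_on)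
  have chain: "relChain ?k (underS ?k)"
    unfolding relChain_def underS_def
    using wo_rel.TRANS[OF wo] wo_rel.ANTISYM[OF wo] by (auto dest: transD antisymD)
  have "Func (Field \<theta>) (Field ?k) \<subseteq> (\<Union>i\<in>Field ?k. Func (Field \<theta>) (underS ?k i))"
  proof
    fix f assume f: "f \<in> Func (Field \<theta>) (Field ?k)"
    have "f ` Field \<theta> \<subseteq> (\<Union>i\<in>Field ?k. underS ?k i)"
    proof
      fix z assume "z \<in> f ` Field \<theta>"
      then have "z \<in> Field ?k" using f by (auto simp: Func_def)
      then obtain b where "b \<in> Field ?k" "z \<noteq> b" "(z, b) \<in> ?k"
        using infinite_Card_order_limit[OF k] by blast
      then show "z \<in> (\<Union>i\<in>Field ?k. underS ?k i)" by (auto simp: underS_def)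
    qed
    moreover have "|f ` Field \<theta>| \<le>o two_pow"
      using \<theta> card_of_image card_of_Field_ordIso ordLeq_two_pow
      by (meson ordLeq_ordIso_trans ordLeq_transitive)
    ultimately obtain i where "i \<in> Field ?k" "f ` Field \<theta> \<subseteq> underS ?k i"
      using cardSuc_UNION_Cinfinite[OF Cinfinite_two_pow chain] by blast
    then show "f \<in> (\<Union>i\<in>Field ?k. Func (Field \<theta>) (underS ?k i))"
      using f by (auto simp: Func_def)
  qed
  then have "|Func (Field \<theta>) (Field ?k)| \<le>o |\<Union>i\<in>Field ?k. Func (Field \<theta>) (underS ?k i)|"
    by (rule card_of_mono1)
  also have "|\<Union>i\<in>Field ?k. Func (Field \<theta>) (underS ?k i)| \<le>o ?k"
  proof (intro UNION_Cinfinite_bound ballI Cinfinite_two_pow_suc)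
    show "|Field ?k| \<le>o ?k" using k by (simp add: card_of_Field_ordIso ordIso_imp_ordLeq)
    fix i assume "i \<in> Field ?k"
    then have "|underS ?k i| <o ?k" by (rule card_of_underS[OF k(1)])
    then have "|underS ?k i| \<le>o two_pow"
      using cardSuc_ordLeq_ordLess[OF conjunct2[OF Cinfinite_two_pow] card_of_Card_order] by metis
    from card_of_Func_two_pow[OF this] two_pow_ordLess_suc
    show "|Func (Field \<theta>) (underS ?k i)| \<le>o ?k"
      by (metis ordLeq_transitive ordLess_imp_ordLeq)
  qed
  finally show ?thesis .
qed

lemma small_subsets_bound:
  assumes C: "|C| \<le>o two_pow_suc"
  shows "|{E. E \<subseteq> C \<and> |E| \<le>o \<theta>}| \<le>o two_pow_suc"
proof (cases "C = {}")
  case True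
  then have "{E. E \<subseteq> C \<and> |E| \<le>o \<theta>} \<subseteq> {{}}" by auto
  then have "|{E. E \<subseteq> C \<and> |E| \<le>o \<theta>}| \<le>o |{{} :: 'a set}|" by (rule card_of_mono1)
  also have "|{{} :: 'a set}| \<le>o two_pow_suc"
    using Cinfinite_two_pow_suc by (intro Card_order_singl_ordLeq) (auto simp: cinfinite_def)
  finally show ?thesis .
next
  case False
  let ?k = two_pow_suc
  have "|C| \<le>o |Field ?k|"
    using C Cinfinite_two_pow_suc
    by (metis card_of_Field_ordIso ordIso_symmetric ordLeq_ordIso_trans)
  then obtain h where h: "h ` Field ?k = C" using card_of_ordLeq2[OF False] by metis
  have "{E. E \<subseteq> C \<and> |E| \<le>o \<theta>} \<subseteq>
    {{}} \<union> (\<lambda>f. h ` f ` Field \<theta>) ` Func (Field \<theta>) (Field ?k)" (is "_ \<subseteq> ?R")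
  proof
    fix E assume "E \<in> {E. E \<subseteq> C \<and> |E| \<le>o \<theta>}"
    then have E: "E \<subseteq> C" "|E| \<le>o \<theta>" by simp_all
    show "E \<in> ?R"
    proof (cases "E = {}")
      case False
      have "|E| \<le>o |Field \<theta>|"
        using E(2) \<theta> by (metis card_of_Field_ordIso ordIso_symmetric ordLeq_ordIso_trans)
      then obtain g where g: "g ` Field \<theta> = E" using card_of_ordLeq2[OF False] by metis
      have "\<exists>z\<in>Field ?k. h z = g t" if "t \<in> Field \<theta>" for t
      proof -
        have "g t \<in> h ` Field ?k" unfolding h using that E(1) g by auto
        then show ?thesis by auto
      qed
      then obtain f where f: "f t \<in> Field ?k" "h (f t) = g t" if "t \<in> Field \<theta>" for t
        by metis
      define f' where "f' t = (if t \<in> Field \<theta> then f t else undefined)" for t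
      have "f' \<in> Func (Field \<theta>) (Field ?k)" using f by (auto simp: Func_def f'_def)
      moreover have "h ` f' ` Field \<theta> = E"
        unfolding g[symmetric] image_image using f(2) by (intro image_cong) (auto simp: f'_def)
      ultimately show ?thesis by blast
    qed simp
  qed
  then have "|{E. E \<subseteq> C \<and> |E| \<le>o \<theta>}| \<le>o |?R|" by (rule card_of_mono1)
  also have "|?R| \<le>o ?k"
  proof (rule Un_Cinfinite_bound[OF _ _ Cinfinite_two_pow_suc])
    show "|{{} :: 'a set}| \<le>o two_pow_suc"
      using Cinfinite_two_pow_suc by (intro Card_order_singl_ordLeq) (auto simp: cinfinite_def)
  qed (rule ordLeq_transitive[OF card_of_image card_of_Func_two_pow_suc])
  finally show ?thesis .
qed

text \<open>
  The closure under an operation on sets of size at most \<open>\<theta>\<close> is reached after \<open>\<kappa> = (2\<^sup>\<theta>)\<^sup>+\<close> steps: by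
  regularity a subset of size at most \<open>\<theta>\<close> of the union already lies in one of the stages, and by the
  previous bound on the number of these subsets no stage has more than \<open>\<kappa>\<close> elements.
\<close>

lemma closed_family_exists:
  fixes F :: "'a set \<Rightarrow> 'a set"
  assumes F: "\<And>E. |E| \<le>o \<theta> \<Longrightarrow> |F E| \<le>o two_pow_suc"
  shows "\<exists>C. |C| \<le>o two_pow_suc \<and> (\<forall>E. E \<subseteq> C \<longrightarrow> |E| \<le>o \<theta> \<longrightarrow> F E \<subseteq> C)"
proof -
  let ?k = two_pow_suc
  have k: "Card_order ?k" "\<not> finite (Field ?k)"
    using Cinfinite_two_pow_suc by (auto simp: cinfinite_def)
  then have wo: "wo_rel ?k" by (simp add: wo_rel_def card_order_on_well_order_on)
  have Fk: "|Field ?k| \<le>o ?k" using k by (simp add: card_of_Field_ordIso ordIso_imp_ordLeq)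
  define G where "G A = (\<Union>E\<in>{E. E \<subseteq> A \<and> |E| \<le>o \<theta>}. F E)" for A
  have G_bound: "|G A| \<le>o ?k" if "|A| \<le>o ?k" for A
    unfolding G_def using F small_subsets_bound[OF that]
    by (intro UNION_Cinfinite_bound ballI Cinfinite_two_pow_suc) auto
  have G_mono: "G A \<subseteq> G A'" if "A \<subseteq> A'" for A A'
    unfolding G_def using that by blast
  define Cs where "Cs = wo_rel.worec ?k (\<lambda>f i. G (\<Union>j\<in>underS ?k i. f j))"
  have Cs: "Cs i = G (\<Union>j\<in>underS ?k i. Cs j)" for i
  proof -
    have "wo_rel.adm_wo ?k (\<lambda>f i. G (\<Union>j\<in>underS ?k i. f j))"
      unfolding wo_rel.adm_wo_def[OF wo] by (metis (mono_tags, lifting) SUP_cong)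
    from wo_rel.worec_fixpoint[OF wo this] show ?thesis
      unfolding Cs_def[symmetric] by metis
  qed
  have underS_sub: "underS ?k i \<subseteq> underS ?k j" if "(i, j) \<in> ?k" for i j
    unfolding underS_def
    using that wo_rel.TRANS[OF wo] wo_rel.ANTISYM[OF wo] by (auto dest: transD antisymD)
  have chain: "relChain ?k Cs"
    unfolding relChain_def
  proof (intro allI impI)
    fix i j assume "(i, j) \<in> ?k"
    then have "(\<Union>l\<in>underS ?k i. Cs l) \<subseteq> (\<Union>l\<in>underS ?k j. Cs l)" using underS_sub by blast
    then show "Cs i \<subseteq> Cs j" using G_mono Cs by metis
  qed
  have Cs_bound: "|Cs i| \<le>o ?k" for i
  proof (induction i rule: wo_rel.well_order_induct[OF wo])
    case (1 i)
    have "|\<Union>j\<in>underS ?k i. Cs j| \<le>o ?k"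
    proof (intro UNION_Cinfinite_bound ballI Cinfinite_two_pow_suc)
      have "underS ?k i \<subseteq> Field ?k" by (auto simp: underS_def Field_def)
      then show "|underS ?k i| \<le>o ?k" using Fk card_of_mono1 ordLeq_transitive by blast
      fix j assume "j \<in> underS ?k i"
      then show "|Cs j| \<le>o ?k" using 1 by (auto simp: underS_def)
    qed
    then show ?case using G_bound Cs by metis
  qed
  define C where "C = (\<Union>i\<in>Field ?k. Cs i)"
  have "|C| \<le>o ?k"
    unfolding C_def using Fk Cs_bound by (intro UNION_Cinfinite_bound ballI Cinfinite_two_pow_suc)
  moreover have "F E \<subseteq> C" if E: "E \<subseteq> C" "|E| \<le>o \<theta>" for E
  proof -
    have "|E| \<le>o two_pow" using E(2) ordLeq_two_pow ordLeq_transitive by blast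
    then obtain i where i: "i \<in> Field ?k" "E \<subseteq> Cs i"
      using cardSuc_UNION_Cinfinite[OF Cinfinite_two_pow chain] E(1) unfolding C_def by blast
    obtain j where j: "j \<in> Field ?k" "i \<noteq> j" "(i, j) \<in> ?k"
      using infinite_Card_order_limit[OF k i(1)] by blast
    then have "E \<subseteq> (\<Union>l\<in>underS ?k j. Cs l)" using i by (auto simp: underS_def)
    then have "F E \<subseteq> Cs j" using E(2) Cs[of j] unfolding G_def by blast
    then show ?thesis using j(1) unfolding C_def by blast
  qed
  ultimately show ?thesis by blast
qed

end

section \<open>Finite joins, ideals and ultrafilters\<close>

abbreviation join :: "'b::boolean_algebra set \<Rightarrow> 'b" where
  "join w \<equiv> Sup_fin (insert bot w)"

lemma join_le_iff: "finite w \<Longrightarrow> join w \<le> x \<longleftrightarrow> (\<forall>a\<in>w. a \<le> x)"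
  by (simp add: Sup_fin.bounded_iff)

lemma le_join: "finite w \<Longrightarrow> a \<in> w \<Longrightarrow> a \<le> join w"
  by (simp add: Sup_fin.coboundedI)

lemma join_in_ideal:
  assumes "ba_ideal I" "finite w" "w \<subseteq> I"
  shows "join w \<in> I"
  using assms(2,3)
proof (induction w rule: finite_induct)
  case empty
  then show ?case using assms(1) by (simp add: ba_ideal_def)
next
  case (insert a w)
  then have "join (insert a w) = sup a (join w)"
    by (simp add: insert_commute[of bot] Sup_fin.insert)
  then show ?case using insert assms(1) by (simp add: ba_ideal_def)
qed

lemma ultrafilterD:
  assumes "ba_ultrafilter U"
  shows "top \<in> U" "bot \<notin> U" "\<And>a b. a \<in> U \<Longrightarrow> a \<le> b \<Longrightarrow> b \<in> U"
    "\<And>a b. a \<in> U \<Longrightarrow> b \<in> U \<Longrightarrow> inf a b \<in> U"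
  using assms by (auto simp: ba_ultrafilter_def ba_proper_filter_def)

lemma ultrafilter_inf:
  assumes "ba_ultrafilter U"
  shows "inf a b \<in> U \<longleftrightarrow> a \<in> U \<and> b \<in> U"
  using ultrafilterD(3,4)[OF assms] by (meson inf_le1 inf_le2)

lemma ultrafilter_compl:
  assumes U: "ba_ultrafilter U"
  shows "- b \<in> U \<longleftrightarrow> b \<notin> U"
proof
  assume "- b \<in> U"
  then show "b \<notin> U"
    using ultrafilter_inf[OF U, of b "- b"] ultrafilterD(2)[OF U] by auto
next
  assume b: "b \<notin> U"
  define F where "F = {c. \<exists>u\<in>U. inf u b \<le> c}"
  have "U \<subseteq> F" by (auto simp: F_def intro: le_infI1)
  moreover have "b \<in> F" using ultrafilterD(1)[OF U] by (auto simp: F_def)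
  ultimately have "\<not> ba_proper_filter F"
    using b U by (auto simp: ba_ultrafilter_def)
  moreover have "top \<in> F" using ultrafilterD(1)[OF U] by (auto simp: F_def)
  moreover have "\<forall>a\<in>F. \<forall>c. a \<le> c \<longrightarrow> c \<in> F" by (auto simp: F_def intro: order_trans)
  moreover have "inf a c \<in> F" if ac: "a \<in> F" "c \<in> F" for a c
  proof -
    obtain u v where "u \<in> U" "inf u b \<le> a" "v \<in> U" "inf v b \<le> c"
      using ac by (auto simp: F_def)
    then have "inf u v \<in> U" "inf (inf u v) b \<le> inf a c"
      using ultrafilterD(4)[OF U] by (auto intro: order_trans[OF inf_mono[OF inf_le1 order_refl]]
          order_trans[OF inf_mono[OF inf_le2 order_refl]])
    then show ?thesis by (auto simp: F_def)
  qed
  ultimately have "bot \<in> F" by (auto simp: ba_proper_filter_def)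
  then obtain u where "u \<in> U" "inf u b \<le> bot" by (auto simp: F_def)
  then have "u \<le> - b" by (simp add: bot.extremum_unique inf_shunt)
  then show "- b \<in> U" using \<open>u \<in> U\<close> ultrafilterD(3)[OF U] by blast
qed

lemma ultrafilter_sup:
  assumes U: "ba_ultrafilter U"
  shows "sup a b \<in> U \<longleftrightarrow> a \<in> U \<or> b \<in> U"
proof -
  have "sup a b \<notin> U \<longleftrightarrow> - sup a b \<in> U" by (simp only: ultrafilter_compl[OF U] not_not)
  also have "\<dots> \<longleftrightarrow> a \<notin> U \<and> b \<notin> U"
    by (simp only: compl_sup ultrafilter_inf[OF U] ultrafilter_compl[OF U])
  finally show ?thesis by blast
qed

definition symdiff :: "'b::boolean_algebra \<Rightarrow> 'b \<Rightarrow> 'b" where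
  "symdiff b c = sup (inf b (- c)) (inf c (- b))"

lemma ultrafilter_symdiff: "ba_ultrafilter x \<Longrightarrow> symdiff b c \<in> x \<longleftrightarrow> (b \<in> x) \<noteq> (c \<in> x)"
  by (auto simp: symdiff_def ultrafilter_sup ultrafilter_inf ultrafilter_compl)

lemma ultrafilter_join:
  assumes U: "ba_ultrafilter U" and w: "finite w"
  shows "join w \<in> U \<longleftrightarrow> (\<exists>a\<in>w. a \<in> U)"
  using w
proof (induction w rule: finite_induct)
  case empty
  then show ?case using ultrafilterD(2)[OF U] by simp
next
  case (insert a w)
  then have "join (insert a w) = sup a (join w)"
    by (simp add: insert_commute[of bot] Sup_fin.insert)
  then show ?case using insert ultrafilter_sup[OF U] by auto
qed

lemma proper_filter_extends:
  assumes "ba_proper_filter F"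
  shows "\<exists>U. ba_ultrafilter U \<and> F \<subseteq> U"
proof -
  let ?A = "{G. ba_proper_filter G \<and> F \<subseteq> G}"
  have "\<exists>M\<in>?A. \<forall>X\<in>?A. M \<subseteq> X \<longrightarrow> X = M"
  proof (rule subset_Zorn_nonempty)
    show "?A \<noteq> {}" using assms by blast
    fix \<C> assume ne: "\<C> \<noteq> {}" and "subset.chain ?A \<C>"
    then have sub: "\<C> \<subseteq> ?A" and ch: "\<And>X Y. X \<in> \<C> \<Longrightarrow> Y \<in> \<C> \<Longrightarrow> X \<subseteq> Y \<or> Y \<subseteq> X"
      by (auto simp: subset_chain_def)
    have "inf a b \<in> \<Union>\<C>" if ab: "a \<in> \<Union>\<C>" "b \<in> \<Union>\<C>" for a b
    proof -
      obtain X Y where XY: "X \<in> \<C>" "Y \<in> \<C>" "a \<in> X" "b \<in> Y" using ab by blast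
      with ch[of X Y] obtain Z where "Z \<in> \<C>" "a \<in> Z" "b \<in> Z" by blast
      moreover have "ba_proper_filter Z" using sub \<open>Z \<in> \<C>\<close> by blast
      ultimately show ?thesis by (auto simp: ba_proper_filter_def)
    qed
    moreover have "c \<in> \<Union>\<C>" if a: "a \<in> \<Union>\<C>" "a \<le> c" for a c
    proof -
      obtain Z where "Z \<in> \<C>" "a \<in> Z" using a by blast
      moreover have "ba_proper_filter Z" using sub \<open>Z \<in> \<C>\<close> by blast
      ultimately show ?thesis using a(2) by (auto simp: ba_proper_filter_def)
    qed
    moreover have "top \<in> \<Union>\<C>" "bot \<notin> \<Union>\<C>"
      using ne sub by (auto simp: ba_proper_filter_def)
    moreover have "F \<subseteq> \<Union>\<C>" using ne sub by blast
    ultimately show "\<Union>\<C> \<in> ?A" by (simp add: ba_proper_filter_def)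
  qed
  then obtain U where U: "ba_proper_filter U" "F \<subseteq> U"
    and max: "\<And>X. ba_proper_filter X \<Longrightarrow> F \<subseteq> X \<Longrightarrow> U \<subseteq> X \<Longrightarrow> X = U"
    by auto
  then have "ba_ultrafilter U" by (auto simp: ba_ultrafilter_def)
  with U show ?thesis by blast
qed

text \<open>
  This is the compactness of the Stone space: an element that is not below a finite join from
  \<open>A\<close> is not covered by \<open>A\<close>.
\<close>

lemma ultrafilter_avoiding:
  assumes "\<And>w. finite w \<Longrightarrow> w \<subseteq> A \<Longrightarrow> \<not> b \<le> join w"
  shows "\<exists>U. ba_ultrafilter U \<and> b \<in> U \<and> U \<inter> A = {}"
proof -
  define F where "F = {c. \<exists>w. finite w \<and> w \<subseteq> A \<and> inf b (- join w) \<le> c}"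
  have F_top: "c \<in> F" if "b \<le> c" for c
    unfolding F_def using that by (auto intro!: exI[of _ "{}"])
  have "bot \<notin> F"
    using assms by (auto simp: F_def bot.extremum_unique inf_shunt)
  moreover have "\<forall>a\<in>F. \<forall>c. a \<le> c \<longrightarrow> c \<in> F"
    unfolding F_def using order_trans by blast
  moreover have "inf c d \<in> F" if cd: "c \<in> F" "d \<in> F" for c d
  proof -
    obtain v w where vw: "finite v" "v \<subseteq> A" "inf b (- join v) \<le> c"
      "finite w" "w \<subseteq> A" "inf b (- join w) \<le> d"
      using cd by (auto simp: F_def)
    have "join v \<le> join (v \<union> w)" "join w \<le> join (v \<union> w)"
      using vw by (auto simp: join_le_iff intro!: le_join)
    then have "inf b (- join (v \<union> w)) \<le> inf c d"
      using vw(3,6) by (meson compl_le_compl_iff inf_greatest inf_mono order_refl order_trans)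
    then show ?thesis using vw unfolding F_def by blast
  qed
  ultimately have "ba_proper_filter F" using F_top by (auto simp: ba_proper_filter_def)
  then obtain U where U: "ba_ultrafilter U" "F \<subseteq> U" using proper_filter_extends by blast
  have "a \<notin> U" if "a \<in> A" for a
  proof -
    have "inf b (- join {a}) \<le> - a" by (simp add: sup.absorb2)
    then have "- a \<in> F" unfolding F_def using that by blast
    then show ?thesis using U ultrafilter_compl by blast
  qed
  moreover have "b \<in> U" using F_top U by auto
  ultimately show ?thesis using U by blast
qed

section \<open>Cofinality of ideals and right-separated sequences\<close>

abbreviation ideal_base :: "'b::boolean_algebra set \<Rightarrow> 'b set \<Rightarrow> bool" where
  "ideal_base I A \<equiv> A \<subseteq> I \<and> (\<forall>b\<in>I. \<exists>a\<in>A. b \<le> a)"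

lemma ideal_cof:
  shows ideal_cof_attained: "\<exists>A. ideal_base I A \<and> ideal_cof I = |A|"
    and ideal_cof_le: "\<And>A. ideal_base I A \<Longrightarrow> ideal_cof I \<le>o |A|"
proof -
  let ?R = "{|A| | A. ideal_base I A}"
  have "|I| \<in> ?R" by auto
  then have ne: "?R \<noteq> {}" by blast
  have co: "Card_order r" if "r \<in> ?R" for r
    using that card_of_Card_order by auto
  show "\<exists>A. ideal_base I A \<and> ideal_cof I = |A|"
    using card_Min(1)[OF ne co] unfolding ideal_cof_def by blast
  show "ideal_cof I \<le>o |A|" if "ideal_base I A" for A
    unfolding ideal_cof_def using that by (intro card_Min(2)[OF ne co]) blast+
qed

lemma Card_order_ideal_cof: "Card_order (ideal_cof I)"
  using ideal_cof_attained[of I] card_of_Card_order by metis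

lemma finite_subsets_bound_strict:
  assumes "|A| <o r" "Cinfinite r"
  shows "|{F. finite F \<and> F \<subseteq> A}| <o r"
proof (cases "finite A")
  case True
  then have "finite {F. finite F \<and> F \<subseteq> A}"
    by (auto intro: finite_subset[OF _ finite_Pow_iff[THEN iffD2]])
  then show ?thesis using assms(2) by (rule finite_ordLess_Cinfinite)
next
  case False
  then have "|{F. finite F \<and> F \<subseteq> A}| \<le>o |A|"
    by (intro finite_subsets_bound)
      (simp_all add: cinfinite_def Field_card_of card_of_card_order_on card_of_refl ordIso_imp_ordLeq)
  with assms(1) show ?thesis using ordLeq_ordLess_trans by blast
qed

text \<open>
  Fewer than \<open>cof(I)\<close> elements of \<open>I\<close> have fewer than \<open>cof(I)\<close> finite joins, so these are not
  cofinal, and the next element can be chosen greedily.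
\<close>

lemma right_separated_of_ideal:
  fixes I :: "'b::boolean_algebra set" and \<kappa> :: "'k rel"
  assumes I: "ba_ideal I" and \<kappa>: "Cinfinite \<kappa>" "\<kappa> \<le>o ideal_cof I"
  shows "\<exists>a :: 'k \<Rightarrow> 'b. right_separated \<kappa> a"
proof -
  have wo: "Well_order \<kappa>" using \<kappa>(1) by (simp add: card_order_on_well_order_on)
  then have wf: "wf (\<kappa> - Id)" by (simp add: well_order_on_def)
  have underS: "y \<in> underS \<kappa> x \<longleftrightarrow> (y, x) \<in> \<kappa> - Id" for x y by (auto simp: underS_def)
  define P where "P f x r \<longleftrightarrow> (x \<in> Field \<kappa> \<longrightarrow>
     r \<in> I \<and> (\<forall>w. finite w \<and> w \<subseteq> underS \<kappa> x \<longrightarrow> \<not> r \<le> join (f ` w)))"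
    for f :: "'k \<Rightarrow> 'b" and x r
  have "\<exists>f. \<forall>x. P f x (f x)"
  proof (rule dependent_wf_choice[OF wf])
    fix f g :: "'k \<Rightarrow> 'b" and x r
    assume "\<And>z. (z, x) \<in> \<kappa> - Id \<Longrightarrow> f z = g z"
    then have "f ` w = g ` w" if "w \<subseteq> underS \<kappa> x" for w
      using that by (intro image_cong) (auto simp: underS)
    then show "P f x r = P g x r" unfolding P_def by metis
  next
    fix x and f :: "'k \<Rightarrow> 'b" assume IH: "\<And>y. (y, x) \<in> \<kappa> - Id \<Longrightarrow> P f y (f y)"
    show "\<exists>r. P f x r"
    proof (cases "x \<in> Field \<kappa>")
      case True
      let ?W = "{w. finite w \<and> w \<subseteq> underS \<kappa> x}"
      have fI: "f y \<in> I" if "y \<in> underS \<kappa> x" for y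
        using that IH[of y] by (auto simp: underS P_def Field_def)
      have "|(\<lambda>w. join (f ` w)) ` ?W| <o \<kappa>"
        by (intro ordLeq_ordLess_trans[OF card_of_image] finite_subsets_bound_strict card_of_underS)
          (use \<kappa>(1) True in auto)
      then have "\<not> ideal_cof I \<le>o |(\<lambda>w. join (f ` w)) ` ?W|"
        using \<kappa>(2) by (meson not_ordLess_ordLeq ordLeq_transitive)
      then have nb: "\<not> ideal_base I ((\<lambda>w. join (f ` w)) ` ?W)"
        by (rule contrapos_nn) (rule ideal_cof_le)
      have "(\<lambda>w. join (f ` w)) ` ?W \<subseteq> I"
        using fI by (auto intro!: join_in_ideal[OF I])
      with nb have "\<exists>r\<in>I. \<forall>w\<in>?W. \<not> r \<le> join (f ` w)" by auto
      then obtain r where "r \<in> I" "\<forall>w\<in>?W. \<not> r \<le> join (f ` w)" ..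
      then have "P f x r" by (simp add: P_def)
      then show ?thesis by blast
    qed (simp add: P_def)
  qed
  then show ?thesis unfolding P_def right_separated_def by blast
qed

lemma right_separated_le_hL:
  fixes a :: "'b \<Rightarrow> 'b::boolean_algebra" and B :: "'b itself"
  assumes "Card_order \<kappa>" "right_separated \<kappa> a"
  shows "\<kappa> \<le>o hL B"
  unfolding hL_def using assms by (intro card_Sup(2)) auto

lemma Card_order_hL: "Card_order (hL B)"
  unfolding hL_def by (rule card_Sup(1)) auto

lemma ideal_cof_le_hL:
  fixes I :: "'b::boolean_algebra set" and B :: "'b itself"
  assumes "ba_ideal I" "Cinfinite (hL B)"
  shows "ideal_cof I \<le>o hL B"
proof (cases "cinfinite (ideal_cof I)")
  case True
  then have "Cinfinite (ideal_cof I)" using Card_order_ideal_cof by blast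
  with right_separated_of_ideal[OF assms(1) this]
  obtain a :: "'b \<Rightarrow> 'b" where "right_separated (ideal_cof I) a"
    using ordLeq_refl by blast
  then show ?thesis using right_separated_le_hL Card_order_ideal_cof by blast
next
  case False
  then have "Cfinite (ideal_cof I)"
    using Card_order_ideal_cof by (auto simp: cinfinite_def cfinite_def)
  then show ?thesis
    using assms(2) Cfinite_ordLess_Cinfinite ordLess_imp_ordLeq by blast
qed

section \<open>The Lindelof degree of subspaces of the Stone space\<close>

lemma openin_Ult_basis: "openin (Ult B) {U. ba_ultrafilter U \<and> b \<in> U}"
  unfolding Ult_def by (rule topology_generated_by_Basis) blast

text \<open>
  The generating family of the topology is closed under binary intersections, so it is a base.
\<close>

lemma openin_Ult_nhd:
  fixes B :: "'b::boolean_algebra itself"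
  assumes "openin (Ult B) V" "x \<in> V" and x: "ba_ultrafilter x"
  shows "\<exists>b\<in>x. \<forall>y. ba_ultrafilter y \<longrightarrow> b \<in> y \<longrightarrow> y \<in> V"
proof -
  have "generate_topology_on {{U. ba_ultrafilter U \<and> b \<in> U} | b :: 'b. True} V"
    using assms(1) unfolding Ult_def openin_topology_generated_by_iff .
  then show ?thesis using assms(2)
  proof (induction rule: generate_topology_on.induct)
    case (Int V W)
    then obtain a where a: "a \<in> x" "\<forall>y. ba_ultrafilter y \<longrightarrow> a \<in> y \<longrightarrow> y \<in> V"
      by auto
    obtain b where b: "b \<in> x" "\<forall>y. ba_ultrafilter y \<longrightarrow> b \<in> y \<longrightarrow> y \<in> W"
      using Int by auto
    show ?case
    proof (intro bexI[of _ "inf a b"] allI impI)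
      show "inf a b \<in> x" using a b ultrafilter_inf[OF x] by simp
      show "y \<in> V \<inter> W" if "ba_ultrafilter y" "inf a b \<in> y" for y
        using that a b ultrafilter_inf[OF that(1)] by simp
    qed
  next
    case (UN K)
    then obtain k where "k \<in> K" "x \<in> k" by blast
    with UN.IH[OF this] show ?case by (meson UnionI)
  next
    case (Basis s)
    then obtain b where "s = {U. ba_ultrafilter U \<and> b \<in> U}" by auto
    with Basis show ?case by auto
  qed simp
qed

lemma Lindelof_degree:
  fixes X :: "'p topology"
  shows Cinfinite_Lindelof_degree: "Cinfinite (Lindelof_degree X)"
    and Lindelof_degree_subcover: "\<And>\<U>. (\<forall>U\<in>\<U>. openin X U) \<Longrightarrow> topspace X \<subseteq> \<Union>\<U> \<Longrightarrow>
       \<exists>\<V>\<subseteq>\<U>. topspace X \<subseteq> \<Union>\<V> \<and> |\<V>| \<le>o Lindelof_degree X"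
    and Lindelof_degree_least: "\<And>\<kappa> :: ('p + nat) rel. Cinfinite \<kappa> \<Longrightarrow>
       (\<And>\<U>. (\<forall>U\<in>\<U>. openin X U) \<Longrightarrow> topspace X \<subseteq> \<Union>\<U> \<Longrightarrow>
          \<exists>\<V>\<subseteq>\<U>. topspace X \<subseteq> \<Union>\<V> \<and> |\<V>| \<le>o \<kappa>) \<Longrightarrow> Lindelof_degree X \<le>o \<kappa>"
proof -
  let ?R = "{\<kappa> :: ('p + nat) rel. Cinfinite \<kappa> \<and>
     (\<forall>\<U>. (\<forall>U\<in>\<U>. openin X U) \<and> topspace X \<subseteq> \<Union>\<U> \<longrightarrow>
        (\<exists>\<V>\<subseteq>\<U>. topspace X \<subseteq> \<Union>\<V> \<and> |\<V>| \<le>o \<kappa>))}"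
  have ne: "?R \<noteq> {}" using Lindelof_degree_exists[of X] by (auto simp only: mem_Collect_eq)
  have co: "Card_order r" if "r \<in> ?R" for r using that by simp
  have L: "Lindelof_degree X \<in> ?R"
    unfolding Lindelof_degree_def using ne co by (rule card_Min(1))
  then show "Cinfinite (Lindelof_degree X)" by simp
  show "\<exists>\<V>\<subseteq>\<U>. topspace X \<subseteq> \<Union>\<V> \<and> |\<V>| \<le>o Lindelof_degree X"
    if "\<forall>U\<in>\<U>. openin X U" "topspace X \<subseteq> \<Union>\<U>" for \<U>
    using L that by simp
  show "Lindelof_degree X \<le>o \<kappa>"
    if "Cinfinite \<kappa>" "\<And>\<U>. (\<forall>U\<in>\<U>. openin X U) \<Longrightarrow> topspace X \<subseteq> \<Union>\<U> \<Longrightarrow>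
          \<exists>\<V>\<subseteq>\<U>. topspace X \<subseteq> \<Union>\<V> \<and> |\<V>| \<le>o \<kappa>" for \<kappa> :: "('p + nat) rel"
    unfolding Lindelof_degree_def using ne co
    by (rule card_Min(2)) (use that in blast)+
qed

text \<open>
  A cardinal below the Lindelof degree has a copy on the type of the degree; this transfers the
  minimality to cardinals on arbitrary types.
\<close>

lemma Lindelof_degree_le:
  fixes X :: "'p topology" and \<kappa> :: "'k rel"
  assumes \<kappa>: "Cinfinite \<kappa>"
    and cov: "\<And>\<U>. (\<forall>U\<in>\<U>. openin X U) \<Longrightarrow> topspace X \<subseteq> \<Union>\<U> \<Longrightarrow>
          \<exists>\<V>\<subseteq>\<U>. topspace X \<subseteq> \<Union>\<V> \<and> |\<V>| \<le>o \<kappa>"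
  shows "Lindelof_degree X \<le>o \<kappa>"
proof (rule ccontr)
  assume *: "\<not> Lindelof_degree X \<le>o \<kappa>"
  then have "\<kappa> <o Lindelof_degree X"
    using \<kappa> Cinfinite_Lindelof_degree[of X] card_not_ordLess[of \<kappa> "Lindelof_degree X"] by simp
  then obtain p :: "('p + nat) rel" where p: "\<kappa> =o p"
    using internalize_ordLess by metis
  have "Lindelof_degree X \<le>o p"
  proof (rule Lindelof_degree_least)
    show "Cinfinite p" using Cinfinite_cong p \<kappa> by blast
    fix \<U> assume "\<forall>U\<in>\<U>. openin X U" "topspace X \<subseteq> \<Union>\<U>"
    from cov[OF this] obtain \<V> where "\<V> \<subseteq> \<U>" "topspace X \<subseteq> \<Union>\<V>" "|\<V>| \<le>o \<kappa>" by blast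
    then show "\<exists>\<V>\<subseteq>\<U>. topspace X \<subseteq> \<Union>\<V> \<and> |\<V>| \<le>o p"
      using ordLeq_ordIso_trans[OF _ p] by blast
  qed
  with * p show False using ordLeq_ordIso_trans ordIso_symmetric by blast
qed

text \<open>
  The elements whose trace on \<open>X\<close> is covered by finitely many members of an open cover form an
  ideal, and the finite subfamilies chosen for a cofinal subset of this ideal together cover \<open>X\<close>.
\<close>

lemma Lindelof_subspace_le:
  fixes B :: "'b::boolean_algebra itself" and \<kappa> :: "'k rel"
  assumes X: "X \<subseteq> topspace (Ult B)" and \<kappa>: "Cinfinite \<kappa>"
    and cof: "\<And>I :: 'b set. ba_ideal I \<Longrightarrow> ideal_cof I \<le>o \<kappa>"
  shows "Lindelof_degree (subtopology (Ult B) X) \<le>o \<kappa>"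
proof (rule Lindelof_degree_le[OF \<kappa>])
  have uf: "ba_ultrafilter x" if "x \<in> X" for x using X that by (auto simp: topspace_Ult)
  have tX: "topspace (subtopology (Ult B) X) = X" using X by (simp add: inf.absorb2)
  fix \<U> assume op: "\<forall>U\<in>\<U>. openin (subtopology (Ult B) X) U"
    and "topspace (subtopology (Ult B) X) \<subseteq> \<Union>\<U>"
  then have cov: "X \<subseteq> \<Union>\<U>" unfolding tX by simp
  define Q where "Q a \<V> \<longleftrightarrow> finite \<V> \<and> \<V> \<subseteq> \<U> \<and> (\<forall>x\<in>X. a \<in> x \<longrightarrow> x \<in> \<Union>\<V>)" for a \<V>
  define I where "I = {a. \<exists>\<V>. Q a \<V>}"
  have "ba_ideal I"
    unfolding ba_ideal_def
  proof (intro conjI ballI allI impI)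
    have "Q bot {}" using uf ultrafilterD(2) by (auto simp: Q_def)
    then show "bot \<in> I" unfolding I_def by blast
  next
    fix a b assume "a \<in> I" "b \<le> a"
    then obtain \<V> where "Q a \<V>" by (auto simp: I_def)
    moreover have "a \<in> x" if "x \<in> X" "b \<in> x" for x
      using ultrafilterD(3)[OF uf[OF that(1)] that(2) \<open>b \<le> a\<close>] .
    ultimately have "Q b \<V>" by (simp add: Q_def)
    then show "b \<in> I" unfolding I_def by blast
  next
    fix a b assume "a \<in> I" "b \<in> I"
    then obtain \<V> \<W> where Q: "Q a \<V>" "Q b \<W>" by (auto simp: I_def)
    have "x \<in> \<Union>(\<V> \<union> \<W>)" if "x \<in> X" "sup a b \<in> x" for x
    proof -
      have "a \<in> x \<or> b \<in> x" using ultrafilter_sup[OF uf[OF that(1)]] that(2) by simp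
      then show ?thesis using Q that(1) by (auto simp: Q_def)
    qed
    with Q have "Q (sup a b) (\<V> \<union> \<W>)" by (simp add: Q_def)
    then show "sup a b \<in> I" unfolding I_def by blast
  qed
  obtain A where A: "ideal_base I A" "ideal_cof I = |A|" using ideal_cof_attained by blast
  have A_le: "|A| \<le>o \<kappa>" using cof[OF \<open>ba_ideal I\<close>] A(2) by simp
  have "\<exists>\<V>. Q a \<V>" if "a \<in> A" for a using that A(1) by (auto simp: I_def)
  then obtain V where V: "\<And>a. a \<in> A \<Longrightarrow> Q a (V a)" by metis
  have "X \<subseteq> \<Union>(\<Union>a\<in>A. V a)"
  proof
    fix x assume x: "x \<in> X"
    then obtain U where U: "U \<in> \<U>" "x \<in> U" using cov by blast
    then obtain W where W: "openin (Ult B) W" "U = W \<inter> X"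
      using op by (auto simp: openin_subtopology)
    then obtain b where b: "b \<in> x" "\<forall>y. ba_ultrafilter y \<longrightarrow> b \<in> y \<longrightarrow> y \<in> W"
      using openin_Ult_nhd[OF W(1) _ uf[OF x]] U(2) by blast
    then have "Q b {U}" using U(1) W(2) uf by (auto simp: Q_def)
    then have "b \<in> I" unfolding I_def by blast
    then obtain a where a: "a \<in> A" "b \<le> a" using A(1) by blast
    then have "a \<in> x" using b(1) ultrafilterD(3)[OF uf[OF x]] by blast
    then have "x \<in> \<Union>(V a)" using V[OF a(1)] x by (auto simp: Q_def)
    then show "x \<in> \<Union>(\<Union>a\<in>A. V a)" using a(1) by blast
  qed
  moreover have "(\<Union>a\<in>A. V a) \<subseteq> \<U>" using V by (auto simp: Q_def)
  moreover have "|\<Union>a\<in>A. V a| \<le>o \<kappa>"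
  proof (intro UNION_Cinfinite_bound A_le ballI \<kappa>)
    fix a assume "a \<in> A"
    then have "finite (V a)" using V by (auto simp: Q_def)
    then have "|V a| <o \<kappa>" using \<kappa> by (rule finite_ordLess_Cinfinite)
    then show "|V a| \<le>o \<kappa>" by (rule ordLess_imp_ordLeq)
  qed
  ultimately show "\<exists>\<V>\<subseteq>\<U>. topspace (subtopology (Ult B) X) \<subseteq> \<Union>\<V> \<and> |\<V>| \<le>o \<kappa>"
    unfolding tX by blast
qed

text \<open>
  The members of \<open>I\<close> cover \<open>X\<close>.  If \<open>A \<subseteq> I\<close> still covers \<open>X\<close>, then by compactness each member of
  \<open>I\<close> is below a finite join from \<open>A\<close>, so these joins are cofinal in \<open>I\<close>.
\<close>

lemma ideal_cof_le_Lindelof: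
  fixes B :: "'b::boolean_algebra itself"
  assumes I: "ba_ideal I"
  defines "X \<equiv> {x. ba_ultrafilter x \<and> x \<inter> I \<noteq> {}}"
  shows "ideal_cof I \<le>o Lindelof_degree (subtopology (Ult B) X)"
proof -
  let ?T = "subtopology (Ult B) X"
  define N where "N a = {x. ba_ultrafilter x \<and> a \<in> x} \<inter> X" for a
  have tX: "topspace ?T = X"
    by (rule topspace_subtopology_subset) (auto simp: X_def topspace_Ult)
  have "\<forall>U\<in>N ` I. openin ?T U"
    unfolding N_def by (auto simp: openin_subtopology intro: openin_Ult_basis)
  moreover have "topspace ?T \<subseteq> \<Union>(N ` I)"
    unfolding tX by (auto simp: N_def X_def)
  ultimately obtain \<V> where \<V>: "\<V> \<subseteq> N ` I" "X \<subseteq> \<Union>\<V>" "|\<V>| \<le>o Lindelof_degree ?T"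
    using Lindelof_degree_subcover[of "N ` I" ?T] unfolding tX by auto
  then obtain A where A: "A \<subseteq> I" "inj_on N A" "\<V> = N ` A"
    by (auto simp: subset_image_inj)
  have "|A| \<le>o |\<V>|" using A by (intro card_of_ordLeqI) auto
  then have A_le: "|A| \<le>o Lindelof_degree ?T" using \<V>(3) ordLeq_transitive by blast
  let ?J = "join ` {w. finite w \<and> w \<subseteq> A}"
  have "?J \<subseteq> I" using A(1) by (auto intro!: join_in_ideal[OF I])
  moreover have "\<exists>a\<in>?J. b \<le> a" if b: "b \<in> I" for b
  proof (rule ccontr)
    assume "\<not> (\<exists>a\<in>?J. b \<le> a)"
    then obtain x where x: "ba_ultrafilter x" "b \<in> x" "x \<inter> A = {}"
      using ultrafilter_avoiding[of A b] by auto
    then have "x \<in> X" using b by (auto simp: X_def)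
    then show False using x(3) \<V>(2) A(3) by (auto simp: N_def)
  qed
  ultimately have "ideal_cof I \<le>o |?J|" by (intro ideal_cof_le) blast
  also have "|?J| \<le>o Lindelof_degree ?T"
    by (rule ordLeq_transitive[OF card_of_image
          finite_subsets_bound[OF A_le Cinfinite_Lindelof_degree]])
  finally show ?thesis .
qed

section \<open>Ideals of elements that are small on prescribed sets of points\<close>

text \<open>
  The trace on the Stone space of a right-separated sequence of length \<open>\<chi>\<close>, with the order
  forgotten: the neighbourhood \<open>a x\<close> of \<open>x\<close> contains only \<open>x\<close> and earlier points, hence fewer than
  \<open>\<chi>\<close>, and of two points the earlier one has a neighbourhood that omits the later one.
\<close>

definition separated_points ::
    "'c rel \<Rightarrow> 'b::boolean_algebra set set \<Rightarrow> ('b set \<Rightarrow> 'b) \<Rightarrow> bool" where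
  "separated_points \<chi> X a \<longleftrightarrow> \<chi> \<le>o |X| \<and>
     (\<forall>x\<in>X. ba_ultrafilter x \<and> a x \<in> x \<and> |{y \<in> X. a x \<in> y}| <o \<chi>) \<and>
     (\<forall>x\<in>X. \<forall>y\<in>X. x \<noteq> y \<longrightarrow> a x \<notin> y \<or> a y \<notin> x)"

text \<open>
  Right-separation says exactly that compactness provides an ultrafilter that contains \<open>a \<xi>\<close> and omits all
  earlier members of the sequence.  Embedding \<open>\<chi>\<close> in \<open>\<kappa>\<close> as an initial segment keeps the order, so
  every point has fewer than \<open>\<chi>\<close> predecessors.
\<close>

lemma separated_points_exist:
  fixes \<kappa> :: "'k rel" and a :: "'k \<Rightarrow> 'b::boolean_algebra" and \<chi> :: "'c rel"
  assumes \<kappa>: "Card_order \<kappa>" "right_separated \<kappa> a" and \<chi>: "Cinfinite \<chi>" "\<chi> \<le>o \<kappa>"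
  shows "\<exists>X a' :: 'b set \<Rightarrow> 'b. separated_points \<chi> X a'"
proof -
  have wo: "wo_rel \<chi>" using \<chi>(1) by (simp add: wo_rel_def card_order_on_well_order_on)
  obtain f where f: "embed \<chi> \<kappa> f" using \<chi>(2) by (auto simp: ordLeq_def)
  have f_inj: "inj_on f (Field \<chi>)"
    using embed_inj_on[OF _ f] \<chi>(1) by (simp add: card_order_on_well_order_on)
  have f_under: "f z \<in> underS \<kappa> (f x)" if "z \<in> underS \<chi> x" for x z
  proof -
    have zx: "(z, x) \<in> \<chi>" "z \<noteq> x" "z \<in> Field \<chi>" "x \<in> Field \<chi>"
      using that by (auto simp: underS_def Field_def)
    then have "(f z, f x) \<in> \<kappa>"
      using embed_compat[OF f] by (auto simp: compat_def)
    moreover have "f z \<noteq> f x" using f_inj zx by (auto dest: inj_onD)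
    ultimately show ?thesis by (simp add: underS_def)
  qed
  have "\<exists>U. ba_ultrafilter U \<and> a (f x) \<in> U \<and> U \<inter> a ` underS \<kappa> (f x) = {}"
    if x: "x \<in> Field \<chi>" for x
  proof (rule ultrafilter_avoiding)
    fix w assume "finite w" "w \<subseteq> a ` underS \<kappa> (f x)"
    then obtain v where v: "v \<subseteq> underS \<kappa> (f x)" "finite v" "w = a ` v"
      using finite_subset_image by metis
    have "f x \<in> Field \<kappa>" using embed_Field[OF f] x by blast
    then show "\<not> a (f x) \<le> join w"
      using \<kappa>(2) v unfolding right_separated_def by blast
  qed
  then obtain U where U: "\<And>x. x \<in> Field \<chi> \<Longrightarrow> ba_ultrafilter (U x)"
    "\<And>x. x \<in> Field \<chi> \<Longrightarrow> a (f x) \<in> U x"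
    "\<And>x. x \<in> Field \<chi> \<Longrightarrow> U x \<inter> a ` underS \<kappa> (f x) = {}"
    by metis
  have notin: "a (f z) \<notin> U x" if "x \<in> Field \<chi>" "z \<in> underS \<chi> x" for x z
    using U(3)[OF that(1)] f_under[OF that(2)] by blast
  have total: "x \<in> underS \<chi> y \<or> y \<in> underS \<chi> x"
    if "x \<in> Field \<chi>" "y \<in> Field \<chi>" "x \<noteq> y" for x y
    using that wo_rel.TOTAL[OF wo] by (auto simp: total_on_def underS_def)
  have U_inj: "inj_on U (Field \<chi>)"
    using total notin U(2) by (metis inj_onI)
  define X where "X = U ` Field \<chi>"
  define a' where "a' y = a (f (inv_into (Field \<chi>) U y))" for y
  have a': "a' (U x) = a (f x)" if "x \<in> Field \<chi>" for x
    using that U_inj by (simp add: a'_def)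
  have "|Field \<chi>| \<le>o |X|" using U_inj by (intro card_of_ordLeqI) (auto simp: X_def)
  then have "\<chi> \<le>o |X|"
    using card_of_Field_ordIso \<chi>(1) ordIso_symmetric ordIso_ordLeq_trans by metis
  moreover have "|{y \<in> X. a' (U x) \<in> y}| <o \<chi>" if x: "x \<in> Field \<chi>" for x
  proof -
    have "{y \<in> X. a' (U x) \<in> y} \<subseteq> U ` (underS \<chi> x \<union> {x})"
    proof
      fix y assume "y \<in> {y \<in> X. a' (U x) \<in> y}"
      then obtain z where z: "z \<in> Field \<chi>" "y = U z" "a (f x) \<in> U z"
        by (auto simp: X_def a'[OF x])
      then have "x \<notin> underS \<chi> z" using notin by blast
      then have "z \<in> underS \<chi> x \<union> {x}" using total[OF x z(1)] by blast
      then show "y \<in> U ` (underS \<chi> x \<union> {x})" using z(2) by blast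
    qed
    then have "|{y \<in> X. a' (U x) \<in> y}| \<le>o |underS \<chi> x \<union> {x}|"
      by (rule surj_imp_ordLeq)
    also have "|underS \<chi> x \<union> {x}| <o \<chi>"
    proof (rule Un_Cinfinite_bound_strict[OF _ _ \<chi>(1)])
      show "|underS \<chi> x| <o \<chi>" using \<chi>(1) x by (simp add: card_of_underS)
      show "|{x}| <o \<chi>" using \<chi>(1) by (intro finite_ordLess_Cinfinite) simp_all
    qed
    finally show ?thesis .
  qed
  moreover have "a' (U x) \<notin> U y \<or> a' (U y) \<notin> U x"
    if "x \<in> Field \<chi>" "y \<in> Field \<chi>" "U x \<noteq> U y" for x y
    using that total[of x y] notin a' by metis
  ultimately have "separated_points \<chi> X a'"
    unfolding separated_points_def using U(1,2) a' by (auto simp: X_def)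
  then show ?thesis by blast
qed

definition small_ideal ::
    "'i set \<Rightarrow> ('i \<Rightarrow> 'c rel) \<Rightarrow> ('i \<Rightarrow> 'b::boolean_algebra set set) \<Rightarrow> 'b set" where
  "small_ideal S \<chi> Y = {b. \<forall>i\<in>S. |{x \<in> Y i. b \<in> x}| <o \<chi> i}"

lemma ba_ideal_small_ideal:
  assumes "\<And>i. i \<in> S \<Longrightarrow> Cinfinite (\<chi> i)"
    and uf: "\<And>i x. i \<in> S \<Longrightarrow> x \<in> Y i \<Longrightarrow> ba_ultrafilter x"
  shows "ba_ideal (small_ideal S \<chi> Y)"
  unfolding ba_ideal_def
proof (intro conjI ballI allI impI)
  have "{x \<in> Y i. bot \<in> x} = {}" if "i \<in> S" for i
    using uf[OF that] ultrafilterD(2) by blast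
  then have "|{x \<in> Y i. bot \<in> x}| <o \<chi> i" if "i \<in> S" for i
    using empty_ordLess[OF assms(1)] that by metis
  then show "bot \<in> small_ideal S \<chi> Y" by (simp add: small_ideal_def)
next
  fix a b assume a: "a \<in> small_ideal S \<chi> Y" "b \<le> a"
  have "{x \<in> Y i. b \<in> x} \<subseteq> {x \<in> Y i. a \<in> x}" if "i \<in> S" for i
    using uf[OF that] ultrafilterD(3) a(2) by blast
  then show "b \<in> small_ideal S \<chi> Y"
    using a(1) ordLess_subset unfolding small_ideal_def by blast
next
  fix a b assume ab: "a \<in> small_ideal S \<chi> Y" "b \<in> small_ideal S \<chi> Y"
  have "|{x \<in> Y i. sup a b \<in> x}| <o \<chi> i" if i: "i \<in> S" for i
  proof (rule ordLess_subset)
    show "{x \<in> Y i. sup a b \<in> x} \<subseteq> {x \<in> Y i. a \<in> x} \<union> {x \<in> Y i. b \<in> x}"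
      using uf[OF i] ultrafilter_sup by blast
    show "|{x \<in> Y i. a \<in> x} \<union> {x \<in> Y i. b \<in> x}| <o \<chi> i"
      using ab i assms(1)[OF i] by (intro Un_Cinfinite_bound_strict) (auto simp: small_ideal_def)
  qed
  then show "sup a b \<in> small_ideal S \<chi> Y" by (simp add: small_ideal_def)
qed

text \<open>
  Fewer than \<open>\<chi>\<^sub>i\<close> elements of the ideal cover fewer than \<open>\<chi>\<^sub>i\<close> points of \<open>Y\<^sub>i\<close>, by regularity, whereas
  a cofinal subset covers all points that the ideal covers.
\<close>

lemma ordLeq_cof_small_ideal:
  assumes i: "i \<in> S" and \<chi>: "Cinfinite (\<chi> i)" "regularCard (\<chi> i)"
    and uf: "\<And>x. x \<in> Y i \<Longrightarrow> ba_ultrafilter x"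
    and large: "\<chi> i \<le>o |{x \<in> Y i. x \<inter> small_ideal S \<chi> Y \<noteq> {}}|"
  shows "\<chi> i \<le>o ideal_cof (small_ideal S \<chi> Y)"
proof -
  let ?J = "small_ideal S \<chi> Y"
  obtain A where A: "ideal_base ?J A" "ideal_cof ?J = |A|" using ideal_cof_attained by blast
  have "\<chi> i \<le>o |A|"
  proof (rule ccontr)
    assume "\<not> \<chi> i \<le>o |A|"
    then have "|A| <o \<chi> i" using \<chi>(1) by (intro card_of_ordLessI) simp_all
    moreover have "\<forall>b\<in>A. |{x \<in> Y i. b \<in> x}| <o \<chi> i"
      using A(1) i by (auto simp: small_ideal_def)
    ultimately have "|\<Union>b\<in>A. {x \<in> Y i. b \<in> x}| <o \<chi> i"
      using \<chi> by (intro card_of_UNION_ordLess_infinite_Field_regularCard)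
    moreover have "{x \<in> Y i. x \<inter> ?J \<noteq> {}} \<subseteq> (\<Union>b\<in>A. {x \<in> Y i. b \<in> x})"
    proof
      fix x assume "x \<in> {x \<in> Y i. x \<inter> ?J \<noteq> {}}"
      then obtain b where b: "x \<in> Y i" "b \<in> x" "b \<in> ?J" by blast
      then obtain c where "c \<in> A" "b \<le> c" using A(1) by blast
      then have "c \<in> x" using uf[OF b(1)] ultrafilterD(3) b(2) by blast
      then show "x \<in> (\<Union>b\<in>A. {x \<in> Y i. b \<in> x})" using b(1) \<open>c \<in> A\<close> by blast
    qed
    ultimately have "|{x \<in> Y i. x \<inter> ?J \<noteq> {}}| <o \<chi> i"
      by (rule ordLess_subset[rotated])
    from not_ordLess_ordLeq[OF this] large show False by (rule notE)
  qed
  then show ?thesis using A(2) by simp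
qed

section \<open>The ideal when large sets tell few elements apart\<close>

definition distinguished :: "'b set set \<Rightarrow> 'b \<Rightarrow> 'b \<Rightarrow> 'b set set" where
  "distinguished Y b c = {x \<in> Y. (b \<in> x) \<noteq> (c \<in> x)}"

text \<open>
  Equivalence modulo small sets on \<open>Y\<^sub>i\<close> has at most \<open>2\<^sup>\<theta>\<close> classes, as \<open>few\<close> shows when applied to a set of
  representatives.  An element is determined modulo the ideal \<open>J\<close> of the everywhere small elements by
  its \<open>\<theta>\<close> many classes.  If \<open>x \<noteq> y\<close> are not covered by \<open>J\<close>, then the symmetric
  difference of their neighbourhoods \<open>a x\<close> and \<open>a y\<close> belongs to \<open>x\<close> or to \<open>y\<close>, so it is not in \<open>J\<close>.
  Hence \<open>J\<close> covers all but at most \<open>2\<^sup>\<theta>\<close> points of each \<open>Y\<^sub>i\<close>.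
\<close>

lemma ideal_of_few_classes:
  fixes \<theta> :: "'i rel" and \<chi> :: "'i \<Rightarrow> 'c rel" and X :: "'i \<Rightarrow> 'b::boolean_algebra set set"
  assumes \<theta>: "Cinfinite \<theta>" and S: "S \<subseteq> Field \<theta>"
    and \<chi>: "\<And>i. i \<in> S \<Longrightarrow> Cinfinite (\<chi> i) \<and> regularCard (\<chi> i) \<and> two_pow \<theta> <o \<chi> i"
    and X: "\<And>i. i \<in> S \<Longrightarrow> separated_points (\<chi> i) (X i) (a i)"
    and Y: "\<And>i. i \<in> S \<Longrightarrow> Y i \<subseteq> X i \<and> \<chi> i \<le>o |Y i|"
    and few: "\<And>i D. i \<in> S \<Longrightarrow>
      (\<And>b c. b \<in> D \<Longrightarrow> c \<in> D \<Longrightarrow> b \<noteq> c \<Longrightarrow> \<chi> i \<le>o |distinguished (Y i) b c| ) \<Longrightarrow>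
      |D| \<le>o two_pow \<theta>"
  shows "\<exists>I :: 'b set. ba_ideal I \<and> (\<forall>i\<in>S. \<chi> i \<le>o ideal_cof I)"
proof -
  have uf: "ba_ultrafilter x" if "i \<in> S" "x \<in> Y i" for i x
    using X[OF that(1)] Y[OF that(1)] that(2) by (auto simp: separated_points_def)
  define J where "J = small_ideal S \<chi> Y"
  have "ba_ideal J"
    unfolding J_def using \<chi> uf by (intro ba_ideal_small_ideal) blast+
  define E where "E i b c \<longleftrightarrow> |distinguished (Y i) b c| <o \<chi> i" for i b c
  have E_refl: "E i b b" if "i \<in> S" for i b
    using empty_ordLess[of "\<chi> i"] \<chi>[OF that] by (simp add: E_def distinguished_def)
  have E_sym: "E i b c \<Longrightarrow> E i c b" for i b c
    unfolding E_def distinguished_def by (erule ordLess_subset[rotated]) auto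
  have E_trans: "E i b d" if "i \<in> S" "E i b c" "E i c d" for i b c d
    unfolding E_def
  proof (rule ordLess_subset)
    show "distinguished (Y i) b d \<subseteq> distinguished (Y i) b c \<union> distinguished (Y i) c d"
      by (auto simp: distinguished_def)
    show "|distinguished (Y i) b c \<union> distinguished (Y i) c d| <o \<chi> i"
      using that \<chi>[OF that(1)] by (intro Un_Cinfinite_bound_strict) (auto simp: E_def)
  qed
  \<comment> \<open>\<open>q i b\<close> represents the class of \<open>b\<close> for \<open>i \<in> S\<close>; the value for other \<open>i\<close> only keeps
    all tuples of classes in one function space over \<open>\<theta>\<close>.\<close>
  define q where "q i b = (if i \<in> S then SOME c. E i b c else bot)" for i b
  have E_q: "E i b (q i b)" if "i \<in> S" for i b
    using someI[of "E i b", OF E_refl[OF that]] that by (simp add: q_def)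
  have q_eq: "q i b = q i c" if "i \<in> S" "E i b c" for i b c
  proof -
    have "E i b = E i c" using E_sym E_trans[OF that(1)] that(2) by blast
    then show ?thesis by (simp add: q_def)
  qed
  have q_range: "|range (q i)| \<le>o two_pow \<theta>" for i
  proof (cases "i \<in> S")
    case True
    show ?thesis
    proof (rule few[OF True])
      fix b c assume bc: "b \<in> range (q i)" "c \<in> range (q i)" "b \<noteq> c"
      then obtain b' c' where b': "b = q i b'" "c = q i c'" by blast
      have "\<not> E i b c"
      proof
        assume "E i b c"
        then have "E i b' c'" using E_q[OF True] E_sym E_trans[OF True] b' by metis
        then show False using q_eq[OF True] b' bc(3) by blast
      qed
      then show "\<chi> i \<le>o |distinguished (Y i) b c|"
        using \<chi>[OF True] card_of_ordLessI unfolding E_def by blast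
    qed
  next
    case False
    then have "range (q i) = {bot}" by (auto simp: q_def)
    then show ?thesis
      using Cinfinite_two_pow[OF \<theta>] by (auto intro!: Card_order_singl_ordLeq simp: cinfinite_def)
  qed
  define Q where "Q = (\<Union>i\<in>Field \<theta>. range (q i))"
  have "|Field \<theta>| \<le>o two_pow \<theta>"
    using ordLeq_two_pow[OF \<theta>] card_of_Field_ordIso \<theta> ordIso_ordLeq_trans by metis
  then have "|Q| \<le>o two_pow \<theta>"
    unfolding Q_def using q_range Cinfinite_two_pow[OF \<theta>]
    by (intro UNION_Cinfinite_bound) simp_all
  then have Func_Q: "|Func (Field \<theta>) Q| \<le>o two_pow \<theta>" by (rule card_of_Func_two_pow[OF \<theta>])
  have "\<chi> i \<le>o |{x \<in> Y i. x \<inter> J \<noteq> {}}|" if i: "i \<in> S" for i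
  proof -
    \<comment> \<open>The points missed by \<open>J\<close> are counted by the classes of their neighbourhoods.\<close>
    define T where "T = {x \<in> Y i. x \<inter> J = {}}"
    define g where "g x = (\<lambda>j. if j \<in> Field \<theta> then q j (a i x) else undefined)" for x
    have "inj_on g T"
    proof (rule inj_onI, rule ccontr)
      fix x y assume xy: "x \<in> T" "y \<in> T" "g x = g y" "x \<noteq> y"
      have sim: "E j (a i x) (a i y)" if j: "j \<in> S" for j
      proof -
        have "q j (a i x) = q j (a i y)"
          using fun_cong[OF xy(3), of j] j S by (auto simp: g_def)
        then show ?thesis using E_q[OF j] E_sym E_trans[OF j] by metis
      qed
      have contra: False if z: "z \<in> T" and
        z': "a i x \<in> z \<and> a i y \<notin> z \<or> a i y \<in> z \<and> a i x \<notin> z" for z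
      proof -
        let ?d = "symdiff (a i x) (a i y)"
        have "{w \<in> Y j. ?d \<in> w} = distinguished (Y j) (a i x) (a i y)" if "j \<in> S" for j
          using uf[OF that] by (auto simp: distinguished_def ultrafilter_symdiff)
        then have "?d \<in> J" using sim by (simp add: J_def small_ideal_def E_def)
        moreover have "ba_ultrafilter z" using z uf[OF i] by (simp add: T_def)
        then have "?d \<in> z" using z' by (auto simp: ultrafilter_symdiff)
        ultimately show False using z by (auto simp: T_def)
      qed
      have "x \<in> X i" "y \<in> X i" using xy Y[OF i] by (auto simp: T_def)
      then have "a i x \<in> x" "a i y \<in> y" "a i x \<notin> y \<or> a i y \<notin> x"
        using X[OF i] xy(4) by (auto simp: separated_points_def)
      then show False using contra[OF xy(1)] contra[OF xy(2)] by blast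
    qed
    moreover have "g x \<in> Func (Field \<theta>) Q" for x by (auto simp: Func_def g_def Q_def)
    ultimately have "|T| \<le>o |Func (Field \<theta>) Q|" by (intro card_of_ordLeqI)
    then have T: "|T| <o \<chi> i"
      using Func_Q \<chi>[OF i] ordLeq_ordLess_trans ordLeq_transitive by metis
    show ?thesis
    proof (rule ccontr)
      assume "\<not> \<chi> i \<le>o |{x \<in> Y i. x \<inter> J \<noteq> {}}|"
      then have "|{x \<in> Y i. x \<inter> J \<noteq> {}}| <o \<chi> i"
        using \<chi>[OF i] by (intro card_of_ordLessI) simp_all
      with T have "|T \<union> {x \<in> Y i. x \<inter> J \<noteq> {}}| <o \<chi> i"
        using \<chi>[OF i] by (intro Un_Cinfinite_bound_strict) auto
      then have "|Y i| <o \<chi> i" by (rule ordLess_subset[rotated]) (auto simp: T_def)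
      from not_ordLess_ordLeq[OF this] show False using Y[OF i] by simp
    qed
  qed
  then have "\<chi> i \<le>o ideal_cof J" if "i \<in> S" for i
    using that \<chi>[OF that] uf[OF that] unfolding J_def by (intro ordLeq_cof_small_ideal) blast+
  with \<open>ba_ideal J\<close> show ?thesis by blast
qed

section \<open>The ideal when large sets tell many elements apart\<close>

lemma not_inj_pigeonhole:
  assumes "|A| <o |D|" "g ` D \<subseteq> A"
  obtains b c where "b \<in> D" "c \<in> D" "b \<noteq> c" "g b = g c"
proof -
  have "\<not> inj_on g D"
  proof
    assume "inj_on g D"
    then have "|D| \<le>o |A|" using assms(2) by (intro card_of_ordLeqI) auto
    with not_ordLess_ordLeq[OF assms(1)] show False ..
  qed
  then show thesis using that by (auto simp: inj_on_def)
qed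

lemma card_of_finite_Func:
  fixes \<theta> :: "'i rel" and A :: "'a set"
  assumes \<theta>: "Cinfinite \<theta>" and "finite A"
  shows "|Func (Field \<theta>) A| \<le>o two_pow \<theta>"
proof (rule card_of_Func_two_pow[OF \<theta>])
  have "|A| <o two_pow \<theta>"
    using assms(2) Cinfinite_two_pow[OF \<theta>] by (rule finite_ordLess_Cinfinite)
  then show "|A| \<le>o two_pow \<theta>" by (rule ordLess_imp_ordLeq)
qed

lemma two_pow_suc_le_subset:
  fixes \<theta> :: "'i rel"
  assumes \<theta>: "Cinfinite \<theta>" and "\<not> |D| \<le>o two_pow \<theta>"
  obtains D' where "D' \<subseteq> D" "|D'| =o two_pow_suc \<theta>"
proof -
  have co: "Card_order (two_pow \<theta>)" using Cinfinite_two_pow[OF \<theta>] by simp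
  have "two_pow \<theta> <o |D|"
    using assms(2) card_not_ordLess[OF co card_of_Card_order] by metis
  then have "two_pow_suc \<theta> \<le>o |D|" using cardSuc_least[OF co card_of_Card_order] by metis
  then have "|Field (two_pow_suc \<theta>)| \<le>o |D|"
    using card_of_Field_ordIso[OF cardSuc_Card_order[OF co]] ordIso_ordLeq_trans by metis
  then obtain f where f: "inj_on f (Field (two_pow_suc \<theta>))" "f ` Field (two_pow_suc \<theta>) \<subseteq> D"
    using card_of_ordLeq by metis
  have "|f ` Field (two_pow_suc \<theta>)| =o |Field (two_pow_suc \<theta>)|"
    by (rule ordIso_symmetric, rule card_of_ordIsoI, rule bij_betw_imageI[OF f(1)]) simp
  then have "|f ` Field (two_pow_suc \<theta>)| =o two_pow_suc \<theta>"
    using card_of_Field_ordIso[OF cardSuc_Card_order[OF co]] ordIso_transitive by metis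
  with f(2) show thesis by (rule that)
qed

definition remainder :: "'b set set \<Rightarrow> 'b set \<Rightarrow> 'b set set" where
  "remainder X E = {x \<in> X. x \<inter> E = {}}"

text \<open>
  The recursion has to choose \<open>c\<^sub>i\<close> so that, for each later \<open>k\<close>, the part of \<open>X\<^sub>k\<close> outside
  all the \<open>c\<^sub>j\<close> chosen so far is still large at stage \<open>k\<close>.  This is arranged by taking all \<open>c\<^sub>i\<close> from one family \<open>C\<close> of size at
  most \<open>(2\<^sup>\<theta>)\<^sup>+ < \<chi>\<^sub>k\<close> and by fixing a point \<open>z\<^sub>k \<in> X\<^sub>k\<close> that is generic for \<open>C\<close>: every region that contains
  \<open>z\<^sub>k\<close> and is described by at most \<open>\<theta>\<close> members of \<open>C\<close> is large.  There are at most \<open>(2\<^sup>\<theta>)\<^sup>+\<close> such regions, so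
  all but a small set of points are generic.  As long as no \<open>c\<^sub>j\<close> contains \<open>z\<^sub>k\<close>, the remainder of \<open>X\<^sub>k\<close>
  contains \<open>z\<^sub>k\<close> and is large.

  At stage \<open>i\<close> the points \<open>z\<^sub>k\<close> and the points \<open>y\<^sub>j\<close> chosen before have at most \<open>2\<^sup>\<theta>\<close> traces of
  elements, so among the \<open>(2\<^sup>\<theta>)\<^sup>+\<close> elements told apart by the remainder of \<open>X\<^sub>i\<close> two have the same
  trace.  Their symmetric difference is \<open>c\<^sub>i\<close>; it contains none of these points, and a generic
  \<open>y\<^sub>i\<close> of the remainder contains it.  So \<open>c\<^sub>j \<in> y\<^sub>i\<close> holds exactly for \<open>i = j\<close>, and as \<open>y\<^sub>i\<close> is generic,
  the region of \<open>X\<^sub>i\<close> described by this pattern is large.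
\<close>

lemma ideal_of_many_classes:
  fixes \<theta> :: "'i rel" and \<chi> :: "'i \<Rightarrow> 'c rel" and X :: "'i \<Rightarrow> 'b::boolean_algebra set set"
  assumes \<theta>: "Cinfinite \<theta>" and S: "S \<subseteq> Field \<theta>"
    and \<chi>: "\<And>i. i \<in> S \<Longrightarrow> Cinfinite (\<chi> i) \<and> regularCard (\<chi> i) \<and> two_pow_suc \<theta> <o \<chi> i"
    and X: "\<And>i. i \<in> S \<Longrightarrow> separated_points (\<chi> i) (X i) (a i)"
    and many: "\<And>i Y. i \<in> S \<Longrightarrow> Y \<subseteq> X i \<Longrightarrow> \<chi> i \<le>o |Y| \<Longrightarrow>
      \<exists>D. (\<forall>b\<in>D. \<forall>c\<in>D. b \<noteq> c \<longrightarrow> \<chi> i \<le>o |distinguished Y b c| ) \<and> \<not> |D| \<le>o two_pow \<theta>"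
  shows "\<exists>I :: 'b set. ba_ideal I \<and> (\<forall>i\<in>S. \<chi> i \<le>o ideal_cof I)"
proof -
  let ?k = "two_pow_suc \<theta>"
  have k: "Cinfinite ?k" by (rule Cinfinite_two_pow_suc[OF \<theta>])
  have uf: "ba_ultrafilter x" if "i \<in> S" "x \<in> X i" for i x
    using X[OF that(1)] that(2) by (auto simp: separated_points_def)
  have Field_\<theta>: "|Field \<theta>| =o \<theta>" using \<theta> by (simp add: card_of_Field_ordIso)
  have image_le: "|f ` T| \<le>o \<theta>" if "T \<subseteq> Field \<theta>" for f :: "'i \<Rightarrow> 'a" and T
    using ordLeq_transitive[OF card_of_image card_of_mono1[OF that]] Field_\<theta>
    by (rule ordLeq_ordIso_trans)
  have S_le: "|S| \<le>o ?k"
    using image_le[OF S, of id] ordLeq_two_pow_suc[OF \<theta>] by (auto intro: ordLeq_transitive)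
  have "\<exists>D. i \<in> S \<longrightarrow> Y \<subseteq> X i \<longrightarrow> \<chi> i \<le>o |Y| \<longrightarrow>
     (\<forall>b\<in>D. \<forall>c\<in>D. b \<noteq> c \<longrightarrow> \<chi> i \<le>o |distinguished Y b c| ) \<and> |D| =o ?k" for i Y
  proof (cases "i \<in> S \<and> Y \<subseteq> X i \<and> \<chi> i \<le>o |Y|")
    case True
    then obtain D0 where D0: "\<forall>b\<in>D0. \<forall>c\<in>D0. b \<noteq> c \<longrightarrow> \<chi> i \<le>o |distinguished Y b c|"
      "\<not> |D0| \<le>o two_pow \<theta>"
      using many[of i Y] by auto
    obtain D where "D \<subseteq> D0" "|D| =o ?k" using two_pow_suc_le_subset[OF \<theta> D0(2)] .
    with D0(1) show ?thesis by (intro exI[of _ D]) auto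
  next
    case False
    then show ?thesis by auto
  qed
  then obtain D where D: "\<And>i Y b c. i \<in> S \<Longrightarrow> Y \<subseteq> X i \<Longrightarrow> \<chi> i \<le>o |Y| \<Longrightarrow>
       b \<in> D i Y \<Longrightarrow> c \<in> D i Y \<Longrightarrow> b \<noteq> c \<Longrightarrow> \<chi> i \<le>o |distinguished Y b c|"
    and D_card: "\<And>i Y. i \<in> S \<Longrightarrow> Y \<subseteq> X i \<Longrightarrow> \<chi> i \<le>o |Y| \<Longrightarrow> |D i Y| =o ?k"
    by metis
  define large where "large i Y \<longleftrightarrow> i \<in> S \<and> Y \<subseteq> X i \<and> \<chi> i \<le>o |Y|" for i Y
  define G where "G Z = (\<lambda>(b, c). symdiff b c) ` (Z \<times> Z)" for Z :: "'b set"
  \<comment> \<open>A family closed under \<open>F\<close> contains every element that the recursion may need after excluding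
    a set \<open>E\<close> of its members; \<open>top\<close> serves to describe the remainder itself as a region.\<close>
  define F where "F E = {top} \<union> (\<Union>i\<in>{i \<in> S. large i (remainder (X i) E)}.
     G (D i (remainder (X i) E)))" for E
  have "|F E| \<le>o ?k" for E
    unfolding F_def
  proof (intro Un_Cinfinite_bound UNION_Cinfinite_bound ballI k)
    show "|{top :: 'b}| \<le>o ?k"
      using k by (intro Card_order_singl_ordLeq) (auto simp: cinfinite_def)
    show "|{i \<in> S. large i (remainder (X i) E)}| \<le>o ?k"
      by (rule ordLeq_transitive[OF card_of_mono1 S_le]) auto
    fix i assume "i \<in> {i \<in> S. large i (remainder (X i) E)}"
    then have "|D i (remainder (X i) E)| \<le>o ?k"
      using D_card ordIso_imp_ordLeq by (auto simp: large_def)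
    then have "|D i (remainder (X i) E) \<times> D i (remainder (X i) E)| \<le>o ?k"
      using k by (intro card_of_Times_ordLeq_infinite_Field) (simp_all add: cinfinite_def)
    then show "|G (D i (remainder (X i) E))| \<le>o ?k"
      unfolding G_def by (rule ordLeq_transitive[OF card_of_image])
  qed
  then obtain C where C_card: "|C| \<le>o ?k"
    and C: "\<And>E. E \<subseteq> C \<Longrightarrow> |E| \<le>o \<theta> \<Longrightarrow> F E \<subseteq> C"
    using closed_family_exists[OF \<theta>, of F] by metis
  have top_C: "top \<in> C"
    using C[of "{}"] image_le[of "{}"] by (auto simp: F_def)

  have top_X: "top \<in> x" if "i \<in> S" "x \<in> X i" for i x
    using ultrafilterD(1)[OF uf[OF that]] .

  define region where "region i c E = {x \<in> remainder (X i) E. c \<in> x}" for i c E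
  define generic where "generic i = {x \<in> X i. \<forall>c\<in>C. \<forall>E. E \<subseteq> C \<longrightarrow> |E| \<le>o \<theta> \<longrightarrow>
     x \<in> region i c E \<longrightarrow> \<chi> i \<le>o |region i c E|}" for i
  have nongeneric: "|X i - generic i| <o \<chi> i" if i: "i \<in> S" for i
  proof -
    let ?P = "{p \<in> C \<times> {E. E \<subseteq> C \<and> |E| \<le>o \<theta>}. \<not> \<chi> i \<le>o |region i (fst p) (snd p)|}"
    have "|C \<times> {E. E \<subseteq> C \<and> |E| \<le>o \<theta>}| \<le>o ?k"
      using k C_card small_subsets_bound[OF \<theta> C_card]
      by (intro card_of_Times_ordLeq_infinite_Field) (simp_all add: cinfinite_def)
    then have "|?P| \<le>o ?k" by (rule ordLeq_transitive[OF card_of_mono1, rotated]) auto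
    then have P: "|?P| <o \<chi> i" by (rule ordLeq_ordLess_trans) (use \<chi>[OF i] in simp)
    have "|\<Union>p\<in>?P. region i (fst p) (snd p)| <o \<chi> i"
      using \<chi>[OF i] P
      by (intro card_of_UNION_ordLess_infinite_Field_regularCard)
        (simp_all add: card_of_ordLessI)
    moreover have "X i - generic i \<subseteq> (\<Union>p\<in>?P. region i (fst p) (snd p))"
    proof
      fix x assume "x \<in> X i - generic i"
      then obtain c E where "c \<in> C" "E \<subseteq> C" "|E| \<le>o \<theta>" "x \<in> region i c E"
        "\<not> \<chi> i \<le>o |region i c E|"
        unfolding generic_def by blast
      then have "(c, E) \<in> ?P" "x \<in> region i (fst (c, E)) (snd (c, E))" by simp_all
      then show "x \<in> (\<Union>p\<in>?P. region i (fst p) (snd p))" by (rule UN_I)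
    qed
    ultimately show ?thesis by (rule ordLess_subset[rotated])
  qed
  have meets_generic: "\<exists>x\<in>Y. x \<in> generic i" if i: "i \<in> S" and Y: "Y \<subseteq> X i" "\<chi> i \<le>o |Y|" for i Y
  proof (rule ccontr)
    assume "\<not> (\<exists>x\<in>Y. x \<in> generic i)"
    then have "|Y| <o \<chi> i"
      using Y(1) by (intro ordLess_subset[OF _ nongeneric[OF i]]) auto
    from not_ordLess_ordLeq[OF this] Y(2) show False ..
  qed
  have "\<exists>z. i \<in> S \<longrightarrow> z \<in> generic i" for i
    using meets_generic[of i "X i"] X[of i] by (auto simp: separated_points_def)
  then obtain z where z: "\<And>i. i \<in> S \<Longrightarrow> z i \<in> generic i" by metis
  have generic_X: "generic i \<subseteq> X i" for i by (auto simp: generic_def)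

  define R where "R = \<theta> - Id"
  have "Well_order \<theta>" using \<theta> by (simp add: card_order_on_well_order_on)
  then have wf: "wf R" by (simp add: R_def well_order_on_def)
  have R_total: "(i, j) \<in> R \<or> (j, i) \<in> R" if "i \<in> S" "j \<in> S" "i \<noteq> j" for i j
    using that S \<open>Well_order \<theta>\<close>
    by (auto simp: R_def well_order_on_def linear_order_on_def total_on_def)
  \<comment> \<open>The pair \<open>r = (c\<^sub>i, y\<^sub>i)\<close> is admissible at stage \<open>i\<close> after the choices \<open>f\<close>.\<close>
  define P where "P f i r \<longleftrightarrow> (i \<in> S \<longrightarrow>
     fst r \<in> C \<and> snd r \<in> generic i \<and> fst r \<in> snd r \<and> (\<forall>k\<in>S. fst r \<notin> z k) \<and>
     (\<forall>j\<in>S. (j, i) \<in> R \<longrightarrow> fst r \<notin> snd (f j) \<and> fst (f j) \<notin> snd r))"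
    for f :: "'i \<Rightarrow> 'b \<times> 'b set" and i r
  have "\<exists>f. \<forall>i. P f i (f i)"
  proof (rule dependent_wf_choice[OF wf])
    fix f g :: "'i \<Rightarrow> 'b \<times> 'b set" and i r
    assume "\<And>j. (j, i) \<in> R \<Longrightarrow> f j = g j"
    then show "P f i r = P g i r" unfolding P_def by auto
  next
    fix i and f :: "'i \<Rightarrow> 'b \<times> 'b set"
    assume IH: "\<And>j. (j, i) \<in> R \<Longrightarrow> P f j (f j)"
    show "\<exists>r. P f i r"
    proof (cases "i \<in> S")
      case i: True
      define T where "T = {j \<in> S. (j, i) \<in> R}"
      have T: "fst (f j) \<in> C" "snd (f j) \<in> generic j" "\<And>k. k \<in> S \<Longrightarrow> fst (f j) \<notin> z k"
        if "j \<in> T" for j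
        using that IH[of j] by (auto simp: T_def P_def)
      define E where "E = (fst \<circ> f) ` T"
      have E: "E \<subseteq> C" "|E| \<le>o \<theta>"
        using T(1) image_le[of T "fst \<circ> f"] S by (auto simp: E_def T_def)
      let ?Y = "remainder (X i) E"
      have "z i \<in> X i" using z[OF i] generic_X by blast
      then have "z i \<in> region i top E"
        using T(3) i top_X[OF i] by (auto simp: region_def remainder_def E_def)
      then have "\<chi> i \<le>o |region i top E|" using z[OF i] top_C E by (auto simp: generic_def)
      moreover have "region i top E = ?Y"
        using top_X[OF i] by (auto simp: region_def remainder_def)
      ultimately have lY: "?Y \<subseteq> X i" "\<chi> i \<le>o |?Y|" by (auto simp: remainder_def)
      \<comment> \<open>The trace of \<open>b\<close> on the generic points and on the points chosen before stage \<open>i\<close>.\<close>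
      define g where "g b = (\<lambda>j. if j \<in> Field \<theta> then
         (j \<in> S \<and> b \<in> z j, j \<in> T \<and> b \<in> snd (f j)) else undefined)" for b
      have "|Func (Field \<theta>) (UNIV :: (bool \<times> bool) set)| \<le>o two_pow \<theta>"
        by (rule card_of_finite_Func[OF \<theta>]) simp
      then have "|Func (Field \<theta>) (UNIV :: (bool \<times> bool) set)| <o ?k"
        using two_pow_ordLess_suc[OF \<theta>] by (rule ordLeq_ordLess_trans)
      then have "|Func (Field \<theta>) (UNIV :: (bool \<times> bool) set)| <o |D i ?Y|"
        using ordIso_symmetric[OF D_card[OF i lY]] by (rule ordLess_ordIso_trans)
      moreover have "g ` D i ?Y \<subseteq> Func (Field \<theta>) UNIV" by (auto simp: g_def Func_def)
      ultimately obtain b c where bc: "b \<in> D i ?Y" "c \<in> D i ?Y" "b \<noteq> c" "g b = g c"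
        by (rule not_inj_pigeonhole)
      let ?d = "symdiff b c"
      have "?d \<in> G (D i ?Y)" using bc by (auto simp: G_def)
      then have "?d \<in> F E" using i lY by (auto simp: F_def large_def)
      then have dC: "?d \<in> C" using C[OF E] by blast
      have d_z: "?d \<notin> z j" if j: "j \<in> S" for j
      proof -
        have "(b \<in> z j) = (c \<in> z j)" using fun_cong[OF bc(4), of j] j S by (auto simp: g_def)
        moreover have "ba_ultrafilter (z j)" using z[OF j] generic_X uf[OF j] by blast
        ultimately show ?thesis by (simp add: ultrafilter_symdiff)
      qed
      have d_f: "?d \<notin> snd (f j)" if j: "j \<in> T" for j
      proof -
        have jS: "j \<in> S" using j by (simp add: T_def)
        then have "(b \<in> snd (f j)) = (c \<in> snd (f j))"
          using fun_cong[OF bc(4), of j] j S by (auto simp: g_def)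
        moreover have "ba_ultrafilter (snd (f j))" using T(2)[OF j] generic_X uf[OF jS] by blast
        ultimately show ?thesis by (simp add: ultrafilter_symdiff)
      qed
      have "distinguished ?Y b c = {x \<in> ?Y. ?d \<in> x}"
        using uf[OF i] lY(1) by (auto simp: distinguished_def ultrafilter_symdiff)
      then have "\<chi> i \<le>o |{x \<in> ?Y. ?d \<in> x}|" using D[OF i lY bc(1-3)] by simp
      then obtain y where y: "y \<in> ?Y" "?d \<in> y" "y \<in> generic i"
        using meets_generic[OF i, of "{x \<in> ?Y. ?d \<in> x}"] lY(1) by auto
      have "fst (f j) \<notin> y" if "j \<in> T" for j
        using y(1) that by (auto simp: remainder_def E_def)
      then have "P f i (?d, y)"
        using dC d_z d_f y by (auto simp: P_def T_def)
      then show ?thesis by blast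
    qed (simp add: P_def)
  qed
  then obtain f where f: "\<And>i. P f i (f i)" by blast
  define c where "c i = fst (f i)" for i
  define y where "y i = snd (f i)" for i
  have c: "c i \<in> C" "y i \<in> generic i" "c i \<in> y i" if "i \<in> S" for i
    using f[of i] that by (auto simp: P_def c_def y_def)
  have c_disj: "c j \<notin> y i" if "i \<in> S" "j \<in> S" "i \<noteq> j" for i j
    using R_total[OF that] f[of i] f[of j] that by (auto simp: P_def c_def y_def)
  define E where "E i = c ` (S - {i})" for i
  define Y where "Y i = region i (c i) (E i)" for i
  have Y_sub: "Y i \<subseteq> X i" for i by (auto simp: Y_def region_def remainder_def)
  have Y_large: "\<chi> i \<le>o |Y i|" if i: "i \<in> S" for i
  proof -
    have "E i \<subseteq> C" "|E i| \<le>o \<theta>" using c(1) image_le[of "S - {i}" c] S by (auto simp: E_def)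
    moreover have "y i \<in> Y i"
      using c(2,3)[OF i] generic_X[of i] c_disj[OF i]
      by (auto simp: Y_def region_def remainder_def E_def)
    ultimately show ?thesis
      using c(1,2)[OF i] unfolding generic_def Y_def by blast
  qed
  define J where "J = small_ideal S \<chi> Y"
  have "ba_ideal J"
    unfolding J_def
  proof (rule ba_ideal_small_ideal)
    show "Cinfinite (\<chi> i)" if "i \<in> S" for i using \<chi>[OF that] by simp
    show "ba_ultrafilter x" if "i \<in> S" "x \<in> Y i" for i x using uf that Y_sub by blast
  qed
  moreover have "\<chi> i \<le>o ideal_cof J" if i: "i \<in> S" for i
    unfolding J_def
  proof (rule ordLeq_cof_small_ideal[OF i])
    show "Cinfinite (\<chi> i)" "regularCard (\<chi> i)" using \<chi>[OF i] by simp_all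
    show "ba_ultrafilter x" if "x \<in> Y i" for x using uf[OF i] that Y_sub by blast
    \<comment> \<open>Cutting the small neighbourhood \<open>a i x\<close> down to \<open>c i\<close> makes its trace on every other \<open>Y j\<close> empty.\<close>
    have "inf (a i x) (c i) \<in> x \<inter> J" if x: "x \<in> Y i" for x
    proof
      have xX: "x \<in> X i" using x Y_sub by blast
      then have ax: "a i x \<in> x" "|{w \<in> X i. a i x \<in> w}| <o \<chi> i"
        using X[OF i] by (auto simp: separated_points_def)
      moreover have "c i \<in> x" using x by (simp add: Y_def region_def)
      ultimately show "inf (a i x) (c i) \<in> x" using ultrafilter_inf[OF uf[OF i xX]] by simp
      have "|{w \<in> Y j. inf (a i x) (c i) \<in> w}| <o \<chi> j" if j: "j \<in> S" for j
      proof (cases "j = i")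
        case True
        have "{w \<in> Y i. inf (a i x) (c i) \<in> w} \<subseteq> {w \<in> X i. a i x \<in> w}"
          using Y_sub uf[OF i] ultrafilter_inf by blast
        from ordLess_subset[OF this ax(2)] show ?thesis using True by simp
      next
        case False
        have "inf (a i x) (c i) \<notin> w" if w: "w \<in> Y j" for w
        proof -
          have "c i \<notin> w" using w i False by (auto simp: Y_def region_def remainder_def E_def)
          moreover have "ba_ultrafilter w" using uf[OF j] w Y_sub by blast
          ultimately show ?thesis by (simp add: ultrafilter_inf)
        qed
        then have none: "{w \<in> Y j. inf (a i x) (c i) \<in> w} = {}" by blast
        show ?thesis unfolding none using empty_ordLess[of "\<chi> j"] \<chi>[OF j] by simp
      qed
      then show "inf (a i x) (c i) \<in> J" by (simp add: J_def small_ideal_def)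
    qed
    then have "{x \<in> Y i. x \<inter> small_ideal S \<chi> Y \<noteq> {}} = Y i" unfolding J_def by blast
    then show "\<chi> i \<le>o |{x \<in> Y i. x \<inter> small_ideal S \<chi> Y \<noteq> {}}|" using Y_large[OF i] by simp
  qed
  ultimately show ?thesis by blast
qed

section \<open>An ideal whose cofinality is at least the singular cardinal\<close>

text \<open>A finite nonempty set has a greatest element, and nothing in the set lies strictly above it.\<close>

lemma cofinal_infinite:
  assumes r: "Well_order r" "Field r \<noteq> {}" and K: "K \<subseteq> Field r" "cofinal K r"
  shows "infinite K"
proof
  assume fin: "finite K"
  have lin: "total_on (Field r) r" "refl_on (Field r) r" "trans r" "antisym r"
    using r(1) by (simp_all add: well_order_on_def linear_order_on_def partial_order_on_def
        preorder_on_def)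
  have "F \<noteq> {} \<longrightarrow> (\<exists>m\<in>F. \<forall>k\<in>F. (k, m) \<in> r)" if "finite F" "F \<subseteq> Field r" for F
    using that
  proof (induction F rule: finite_induct)
    case (insert x F)
    show ?case
    proof (cases "F = {}")
      case True
      then show ?thesis using lin(2) insert.prems by (auto simp: refl_on_def)
    next
      case False
      then obtain m where m: "m \<in> F" "\<forall>k\<in>F. (k, m) \<in> r" using insert by auto
      have xx: "(x, x) \<in> r" using lin(2) insert.prems by (auto simp: refl_on_def)
      show ?thesis
      proof (cases "(x, m) \<in> r")
        case True
        then show ?thesis using m by auto
      next
        case False
        then have "(m, x) \<in> r"
          using lin(1) m(1) xx insert.prems by (auto simp: total_on_def)
        then have "\<forall>k\<in>insert x F. (k, x) \<in> r" using m(2) lin(3) xx by (auto dest: transD)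
        then show ?thesis by blast
      qed
    qed
  qed simp
  moreover have "K \<noteq> {}" using r(2) K(2) by (auto simp: cofinal_def)
  ultimately obtain m where m: "m \<in> K" "\<forall>k\<in>K. (k, m) \<in> r" using fin K(1) by blast
  then have "m \<in> Field r" using K(1) by blast
  then obtain b where "b \<in> K" "m \<noteq> b" "(m, b) \<in> r" using K(2) unfolding cofinal_def by blast
  then show False using m(2) lin(4) by (auto dest: antisymD)
qed

lemma Cinfinite_cofinality:
  assumes r: "Cinfinite r"
  shows "Cinfinite (cofinality r)"
proof -
  let ?R = "{|K| | K. K \<subseteq> Field r \<and> cofinal K r}"
  have "cofinal (Field r) r"
    using infinite_Card_order_limit[of r] r by (simp add: cofinal_def cinfinite_def)
  then have "|Field r| \<in> ?R" by blast
  then have ne: "?R \<noteq> {}" by blast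
  have co: "Card_order s" if "s \<in> ?R" for s
    using that card_of_Card_order by auto
  have "cofinality r \<in> ?R" unfolding cofinality_def using ne co by (rule card_Min(1))
  then obtain K where K: "K \<subseteq> Field r" "cofinal K r" "cofinality r = |K|" by blast
  have "Field r \<noteq> {}" using r by (auto simp: cinfinite_def)
  then have "infinite K" using r K by (intro cofinal_infinite) (simp_all add: card_order_on_well_order_on)
  then show ?thesis using K(3) by (simp add: cinfinite_def Field_card_of card_of_card_order_on)
qed

lemma Card_order_ordLeq_total: "Card_order r \<Longrightarrow> Card_order s \<Longrightarrow> r \<le>o s \<or> s \<le>o r"
  by (simp add: card_order_on_well_order_on ordLeq_total)

lemma card_Sup_cardSuc_attained:
  fixes A :: "'a set rel set" and lam :: "'l rel"
  assumes lam: "Card_order lam"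
    and A: "\<And>s. s \<in> A \<Longrightarrow> \<exists>r. s = cardSuc r \<and> Card_order r \<and> r \<le>o lam"
    and r0: "cardSuc r0 \<in> A" "Card_order r0" "lam \<le>o r0"
  shows "card_Sup A =o cardSuc lam"
proof -
  have co: "Card_order s" if "s \<in> A" for s using A[OF that] cardSuc_Card_order by blast
  have "card_Sup A \<le>o cardSuc lam"
  proof (rule card_Sup(3))
    show "Card_order (cardSuc lam)" using lam by (rule cardSuc_Card_order)
    fix s assume "s \<in> A"
    then obtain r where "s = cardSuc r" "Card_order r" "r \<le>o lam" using A by blast
    then show "s \<le>o cardSuc lam" using cardSuc_mono_ordLeq[of r lam] lam by simp
  qed (rule co)
  moreover have "cardSuc lam \<le>o cardSuc r0" using cardSuc_mono_ordLeq[of lam r0] lam r0 by simp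
  moreover have "cardSuc r0 \<le>o card_Sup A" using co r0(1) by (rule card_Sup(2))
  ultimately show ?thesis using ordLeq_transitive ordIso_iff_ordLeq by metis
qed

text \<open>
  Each index falls under one of the two cases, so every \<open>\<chi>\<^sub>i\<close> is bounded by the cofinality of one of two
  ideals.  Cofinalities being comparable, the larger one bounds all \<open>\<chi>\<^sub>i\<close> and hence their supremum.
\<close>

lemma ideal_of_large_cofinality:
  fixes \<theta> :: "'i rel" and \<chi> :: "'i \<Rightarrow> 'c rel" and B :: "'b::boolean_algebra itself"
    and lam :: "'l rel"
  assumes \<theta>: "Cinfinite \<theta>" and lam: "Card_order lam"
    and \<chi>: "\<And>i. i \<in> Field \<theta> \<Longrightarrow> Cinfinite (\<chi> i) \<and> regularCard (\<chi> i) \<and> two_pow_suc \<theta> <o \<chi> i"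
    and \<chi>_hL: "\<And>i. i \<in> Field \<theta> \<Longrightarrow> \<chi> i <o hL B"
    and sup: "\<And>s :: 'b rel. Card_order s \<Longrightarrow> (\<And>i. i \<in> Field \<theta> \<Longrightarrow> \<chi> i \<le>o s) \<Longrightarrow> lam \<le>o s"
  shows "\<exists>I :: 'b set. ba_ideal I \<and> lam \<le>o ideal_cof I"
proof -
  have "\<exists>X (a :: 'b set \<Rightarrow> 'b). separated_points (\<chi> i) X a" if i: "i \<in> Field \<theta>" for i
  proof -
    let ?H = "{\<kappa> :: 'b rel. Card_order \<kappa> \<and> (\<exists>a :: 'b \<Rightarrow> 'b. right_separated \<kappa> a)}"
    have ci: "Cinfinite (\<chi> i)" using \<chi>[OF i] by simp
    have "\<exists>\<kappa>\<in>?H. \<chi> i \<le>o \<kappa>"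
    proof (rule ccontr)
      assume no: "\<not> (\<exists>\<kappa>\<in>?H. \<chi> i \<le>o \<kappa>)"
      have "hL B \<le>o \<chi> i"
        unfolding hL_def
      proof (rule card_Sup(3))
        show "Card_order (\<chi> i)" using ci by simp
        show "\<kappa> \<le>o \<chi> i" if "\<kappa> \<in> ?H" for \<kappa>
          using Card_order_ordLeq_total[of \<kappa> "\<chi> i"] no that ci by auto
      qed simp
      with not_ordLess_ordLeq[OF \<chi>_hL[OF i]] show False ..
    qed
    then show ?thesis using separated_points_exist[OF _ _ ci] by auto
  qed
  then obtain X and a :: "'i \<Rightarrow> 'b set \<Rightarrow> 'b"
    where X: "\<And>i. i \<in> Field \<theta> \<Longrightarrow> separated_points (\<chi> i) (X i) (a i)" by metis
  define few where "few i Y \<longleftrightarrow> (\<forall>D. (\<forall>b\<in>D. \<forall>c\<in>D. b \<noteq> c \<longrightarrow> \<chi> i \<le>o |distinguished Y b c| ) \<longrightarrow>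
      |D| \<le>o two_pow \<theta>)" for i and Y :: "'b set set"
  define S where "S = {i \<in> Field \<theta>. \<exists>Y\<subseteq>X i. \<chi> i \<le>o |Y| \<and> few i Y}"
  have "\<forall>i\<in>S. \<exists>Y. Y \<subseteq> X i \<and> \<chi> i \<le>o |Y| \<and> few i Y" by (auto simp: S_def)
  then obtain Y where "\<forall>i\<in>S. Y i \<subseteq> X i \<and> \<chi> i \<le>o |Y i| \<and> few i (Y i)"
    using bchoice[of S "\<lambda>i Y. Y \<subseteq> X i \<and> \<chi> i \<le>o |Y| \<and> few i Y"] by blast
  then have Y: "\<And>i. i \<in> S \<Longrightarrow> Y i \<subseteq> X i \<and> \<chi> i \<le>o |Y i|" "\<And>i. i \<in> S \<Longrightarrow> few i (Y i)"
    by simp_all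
  have "\<exists>I :: 'b set. ba_ideal I \<and> (\<forall>i\<in>S. \<chi> i \<le>o ideal_cof I)"
  proof (rule ideal_of_few_classes[OF \<theta>, of S \<chi> X a Y])
    show "S \<subseteq> Field \<theta>" by (auto simp: S_def)
    then show "Cinfinite (\<chi> i) \<and> regularCard (\<chi> i) \<and> two_pow \<theta> <o \<chi> i" if "i \<in> S" for i
      using \<chi>[of i] that ordLess_transitive[OF two_pow_ordLess_suc[OF \<theta>], of "\<chi> i"] by auto
    show "separated_points (\<chi> i) (X i) (a i)" if "i \<in> S" for i
      using X that by (simp add: S_def)
    show "Y i \<subseteq> X i \<and> \<chi> i \<le>o |Y i|" if "i \<in> S" for i using Y(1)[OF that] .
    show "|D| \<le>o two_pow \<theta>"
      if "i \<in> S" "\<And>b c. b \<in> D \<Longrightarrow> c \<in> D \<Longrightarrow> b \<noteq> c \<Longrightarrow> \<chi> i \<le>o |distinguished (Y i) b c|" for i D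
      using Y(2)[OF that(1)] that(2) by (simp add: few_def)
  qed
  then obtain I1 :: "'b set" where I1: "ba_ideal I1" "\<And>i. i \<in> S \<Longrightarrow> \<chi> i \<le>o ideal_cof I1" by blast
  have "\<exists>I :: 'b set. ba_ideal I \<and> (\<forall>i\<in>Field \<theta> - S. \<chi> i \<le>o ideal_cof I)"
  proof (rule ideal_of_many_classes[OF \<theta>, of "Field \<theta> - S" \<chi> X a])
    show "\<exists>D. (\<forall>b\<in>D. \<forall>c\<in>D. b \<noteq> c \<longrightarrow> \<chi> i \<le>o |distinguished Y b c| ) \<and> \<not> |D| \<le>o two_pow \<theta>"
      if "i \<in> Field \<theta> - S" "Y \<subseteq> X i" "\<chi> i \<le>o |Y|" for i Y
    proof -
      have "\<not> few i Y" using that by (auto simp: S_def)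
      then show ?thesis by (simp add: few_def)
    qed
  qed (use \<chi> X in auto)
  then obtain I2 :: "'b set"
    where I2: "ba_ideal I2" "\<And>i. i \<in> Field \<theta> - S \<Longrightarrow> \<chi> i \<le>o ideal_cof I2" by blast
  from Card_order_ordLeq_total[OF Card_order_ideal_cof Card_order_ideal_cof, of I1 I2]
  obtain I where I: "I = I1 \<or> I = I2" "ideal_cof I1 \<le>o ideal_cof I" "ideal_cof I2 \<le>o ideal_cof I"
    using ordLeq_refl[OF Card_order_ideal_cof] by metis
  have "lam \<le>o ideal_cof I"
  proof (rule sup[OF Card_order_ideal_cof])
    fix i assume "i \<in> Field \<theta>"
    then have "\<chi> i \<le>o ideal_cof I1 \<or> \<chi> i \<le>o ideal_cof I2" using I1(2) I2(2) by auto
    then show "\<chi> i \<le>o ideal_cof I"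
      using ordLeq_transitive[OF _ I(2), of "\<chi> i"] ordLeq_transitive[OF _ I(3), of "\<chi> i"] by auto
  qed
  with I(1) I1(1) I2(1) show ?thesis by auto
qed

theorem theorem2p4:
  fixes \<mu> :: "'m rel" and lam :: "'l rel" and \<chi> :: "'l \<Rightarrow> 'c rel"
    and B :: "'b::boolean_algebra itself"
  assumes "Cinfinite \<mu>" and "Cinfinite lam"
    and "\<And>i. i \<in> Field (cofinality lam) \<Longrightarrow> Cinfinite (\<chi> i) \<and> regularCard (\<chi> i)"
    and "\<And>i j. (i, j) \<in> cofinality lam \<Longrightarrow> i \<noteq> j \<Longrightarrow> \<chi> i <o \<chi> j"
    and "cofinality lam <o \<mu>"
    and "\<mu> =o cardSuc (ctwo ^c cofinality lam)"
    and "\<mu> <o lam"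
    and "lam =o card_Sup (\<chi> ` Field (cofinality lam))"
    and "\<mu> <o \<chi> (wo_rel.minim (cofinality lam) (Field (cofinality lam)))"
    and "hL B =o lam"
  shows "hL0_plus B =o cardSuc lam \<and> hL1_plus B =o cardSuc lam \<and> hL7_plus B =o cardSuc lam"
proof -
  let ?th = "cofinality lam"
  note lam = assms(2)
  have th: "Cinfinite ?th" by (rule Cinfinite_cofinality[OF lam])
  then have wo: "wo_rel ?th" by (simp add: wo_rel_def card_order_on_well_order_on)
  have hL_inf: "Cinfinite (hL B)" using Cinfinite_cong[OF ordIso_symmetric[OF assms(10)] lam] .
  have \<chi>_co: "Card_order r" if "r \<in> \<chi> ` Field ?th" for r using that assms(3) by blast
  have big: "two_pow_suc ?th <o \<chi> i" if i: "i \<in> Field ?th" for i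
  proof -
    let ?m = "wo_rel.minim ?th (Field ?th)"
    have m: "two_pow_suc ?th <o \<chi> ?m"
      using ordIso_ordLess_trans[OF ordIso_symmetric[OF assms(6)] assms(9)] .
    have "(?m, i) \<in> ?th" using wo_rel.minim_least[OF wo _ i] by simp
    then show ?thesis
      using m assms(4)[of ?m i] ordLess_transitive[OF m, of "\<chi> i"] by (cases "?m = i") auto
  qed
  have below: "\<chi> i <o hL B" if i: "i \<in> Field ?th" for i
  proof -
    obtain j where j: "j \<in> Field ?th" "i \<noteq> j" "(i, j) \<in> ?th"
      using infinite_Card_order_limit[OF _ _ i] th by (auto simp: cinfinite_def)
    have "\<chi> i <o \<chi> j" using assms(4) j by blast
    also have "\<chi> j \<le>o card_Sup (\<chi> ` Field ?th)" using j(1) by (intro card_Sup(2) \<chi>_co) auto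
    also have "card_Sup (\<chi> ` Field ?th) =o lam" using assms(8) by (rule ordIso_symmetric)
    also have "lam =o hL B" using assms(10) by (rule ordIso_symmetric)
    finally show ?thesis .
  qed
  have "\<exists>I :: 'b set. ba_ideal I \<and> lam \<le>o ideal_cof I"
  proof (rule ideal_of_large_cofinality[OF th _ _ below])
    show "Card_order lam" using lam by simp
    show "Cinfinite (\<chi> i) \<and> regularCard (\<chi> i) \<and> two_pow_suc ?th <o \<chi> i" if "i \<in> Field ?th" for i
      using assms(3)[OF that] big[OF that] by simp
    fix s :: "'b rel" assume s: "Card_order s" "\<And>i. i \<in> Field ?th \<Longrightarrow> \<chi> i \<le>o s"
    have "card_Sup (\<chi> ` Field ?th) \<le>o s"
      using \<chi>_co s by (intro card_Sup(3)) auto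
    then show "lam \<le>o s" by (rule ordIso_ordLeq_trans[OF assms(8)])
  qed
  then obtain I :: "'b set" where I: "ba_ideal I" "lam \<le>o ideal_cof I" by blast
  have cof_le: "ideal_cof I' \<le>o lam" if "ba_ideal I'" for I' :: "'b set"
    using ideal_cof_le_hL[OF that hL_inf] assms(10) by (rule ordLeq_ordIso_trans)
  have lam_co: "Card_order lam" using lam by simp

  have "hL1_plus B =o cardSuc lam"
    unfolding hL1_plus_def
  proof (rule card_Sup_cardSuc_attained[OF lam_co _ _ Card_order_ideal_cof I(2)])
    show "\<exists>r. s = cardSuc r \<and> Card_order r \<and> r \<le>o lam"
      if "s \<in> {cardSuc (ideal_cof I) | I :: 'b set. ba_ideal I}" for s
      using that cof_le Card_order_ideal_cof by blast
  qed (use I(1) in blast)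
  moreover have "hL7_plus B =o cardSuc lam"
    unfolding hL7_plus_def
  proof (rule card_Sup_cardSuc_attained[OF lam_co _ _ Card_order_ideal_cof I(2)])
    show "\<exists>r. s = cardSuc r \<and> Card_order r \<and> r \<le>o lam"
      if "s \<in> {cardSuc \<kappa> | \<kappa>. Card_order \<kappa> \<and> (\<exists>a :: 'b \<Rightarrow> 'b. right_separated \<kappa> a)}" for s
    proof -
      obtain \<kappa> and a :: "'b \<Rightarrow> 'b" where "s = cardSuc \<kappa>" "Card_order \<kappa>" "right_separated \<kappa> a"
        using \<open>s \<in> _\<close> by blast
      moreover from this have "\<kappa> \<le>o lam"
        using ordLeq_ordIso_trans[OF right_separated_le_hL assms(10)] by blast
      ultimately show ?thesis by blast
    qed
    have "Cinfinite (ideal_cof I)"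
      using I(2) lam cinfinite_mono Card_order_ideal_cof by blast
    from right_separated_of_ideal[OF I(1) this ordLeq_refl[OF Card_order_ideal_cof]]
    show "cardSuc (ideal_cof I) \<in>
       {cardSuc \<kappa> | \<kappa>. Card_order \<kappa> \<and> (\<exists>a :: 'b \<Rightarrow> 'b. right_separated \<kappa> a)}"
      using Card_order_ideal_cof by blast
  qed
  moreover have "hL0_plus B =o cardSuc lam"
    unfolding hL0_plus_def
  proof (rule card_Sup_cardSuc_attained[OF lam_co])
    show "\<exists>r. s = cardSuc r \<and> Card_order r \<and> r \<le>o lam"
      if "s \<in> {cardSuc (Lindelof_degree (subtopology (Ult B) X)) | X. X \<subseteq> topspace (Ult B)}" for s
    proof -
      obtain X where X: "X \<subseteq> topspace (Ult B)"
        "s = cardSuc (Lindelof_degree (subtopology (Ult B) X))"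
        using \<open>s \<in> _\<close> by blast
      then show ?thesis
        using Lindelof_subspace_le[OF X(1) lam cof_le]
          Cinfinite_Lindelof_degree[of "subtopology (Ult B) X"] by blast
    qed
    let ?X = "{x. ba_ultrafilter x \<and> x \<inter> I \<noteq> {}}"
    have "?X \<subseteq> topspace (Ult B)" by (auto simp: topspace_Ult)
    then show "cardSuc (Lindelof_degree (subtopology (Ult B) ?X)) \<in>
       {cardSuc (Lindelof_degree (subtopology (Ult B) X)) | X. X \<subseteq> topspace (Ult B)}" by blast
    show "Card_order (Lindelof_degree (subtopology (Ult B) ?X))"
      using Cinfinite_Lindelof_degree by blast
    show "lam \<le>o Lindelof_degree (subtopology (Ult B) ?X)"
      using I(2) ideal_cof_le_Lindelof[OF I(1)] by (rule ordLeq_transitive)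
  qed
  ultimately show ?thesis by blast
qed

end
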